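(* Let $t\ge 1$ be a fixed integer. In the insertion-only streaming model, any (randomized, single-pass) algorithm that can distinguish whether a graph on $4n$ vertices is cycle-free or is $1/(8t)$-far from being cycle-free must use $\Omega(n^{1-1/t})$ bits of space.
   Context: In the insertion-only streaming model the input graph is given as a stream of edge insertions and no deletions. The algorithm is randomized and required to succeed with constant probability. A graph is cycle-free if it is a forest. A graph with $m$ edges is $\delta$-far from being cycle-free if one has to delete (modify) more than $\delta m$ edges to make it cycle-free. *)

theory Defs
  imports "HOL-Probability.Probability" "HOL-Library.Landau_Symbols"
begin

text \<open>Simple undirected graphs on the vertex set \<open>{0, ..., N - 1}\<close> are given by their edge sets.\<close>

type_synonym edge = "nat set"

definition all_edges :: "nat \<Rightarrow> edge set" where
  "all_edges N = {{u, v} | u v. u < N \<and> v < N \<and> u \<noteq> v}"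

definition is_cycle :: "edge set \<Rightarrow> nat list \<Rightarrow> bool" where
  "is_cycle E vs \<longleftrightarrow> length vs \<ge> 3 \<and> distinct vs \<and>
     (\<forall>i. Suc i < length vs \<longrightarrow> {vs ! i, vs ! Suc i} \<in> E) \<and> {last vs, hd vs} \<in> E"

definition cycle_free :: "edge set \<Rightarrow> bool" where
  "cycle_free E \<longleftrightarrow> (\<nexists>vs. is_cycle E vs)"

definition far_from_cycle_free :: "real \<Rightarrow> edge set \<Rightarrow> bool" where
  "far_from_cycle_free \<delta> E \<longleftrightarrow>
     (\<forall>D \<subseteq> E. cycle_free (E - D) \<longrightarrow> real (card D) > \<delta> * real (card E))"

definition graph_stream :: "nat \<Rightarrow> edge list \<Rightarrow> bool" where
  "graph_stream N es \<longleftrightarrow> distinct es \<and> set es \<subseteq> all_edges N"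

text \<open>
  The memory contents between two stream elements are a bit string. The initialisation, the
  update and the output may toss fresh coins. A streaming algorithm is a distribution over such
  machines; drawing the machine models a random string that stays readable throughout the
  stream and is not charged as space. Machines without coins and point distributions are
  included, so this covers deterministic algorithms and both conventions for randomness.
\<close>

record machine =
  initial :: "bool list pmf"
  update :: "edge \<Rightarrow> bool list \<Rightarrow> bool list pmf"
  verdict :: "bool list \<Rightarrow> bool pmf"

type_synonym streaming_algorithm = "machine pmf"

definition memory_after :: "machine \<Rightarrow> edge list \<Rightarrow> bool list pmf" where
  "memory_after M es = foldl (\<lambda>\<sigma> e. bind_pmf \<sigma> (update M e)) (initial M) es"

definition answer :: "streaming_algorithm \<Rightarrow> edge list \<Rightarrow> bool pmf" where
  "answer A es = bind_pmf A (\<lambda>M. bind_pmf (memory_after M es) (verdict M))"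

text \<open>The space is the worst case over all streams and all coin tosses. Every prefix of a graph
  stream is a graph stream, so all intermediate memory contents are bounded as well.\<close>

definition uses_at_most_bits :: "nat \<Rightarrow> streaming_algorithm \<Rightarrow> nat \<Rightarrow> bool" where
  "uses_at_most_bits N A s \<longleftrightarrow>
     (\<forall>M \<in> set_pmf A. \<forall>es. graph_stream N es \<longrightarrow>
        (\<forall>\<sigma> \<in> set_pmf (memory_after M es). length \<sigma> \<le> s))"

text \<open>The answer \<open>True\<close> stands for ``cycle-free''.\<close>

definition distinguishes_cycle_free ::
    "nat \<Rightarrow> real \<Rightarrow> real \<Rightarrow> streaming_algorithm \<Rightarrow> bool" where
  "distinguishes_cycle_free N \<delta> p A \<longleftrightarrow>
     (\<forall>es. graph_stream N es \<longrightarrow>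
        (cycle_free (set es) \<longrightarrow> pmf (answer A es) True \<ge> p) \<and>
        (far_from_cycle_free \<delta> (set es) \<longrightarrow> pmf (answer A es) False \<ge> p))"

end

theory Submission
  imports Defs "HOL-Combinatorics.Permutations"
begin

text \<open>
  Put \<open>k = 2 t\<close>. The first part of the stream encodes a set \<open>X\<close> of variables arranged in a grid with
  \<open>k\<close> columns, the second part a random permutation of the grid and one bit per gadget, where the
  gadgets are the first \<open>g\<close> rows of the permuted grid. If the bits are the parities of \<open>X\<close> on the
  gadgets, every gadget contains a cycle; if they are the negated parities, the graph is a union of
  paths. All but a small fraction of the rows are gadgets, so that in the first case the
  graph is \<open>1 / (8 t)\<close>-far from cycle-free.

  The bits are flipped one gadget at a time. Fix the permutation and \<open>X\<close> on the other gadgets: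
  the flipped gadget is still a random choice of one entry per column among \<open>L = \<Theta>(n)\<close> unused rows, so
  the distinguishing advantage for this flip is an average of a degree \<open>k\<close> multilinear polynomial with
  coefficients at most \<open>L ^ - k\<close> against the distribution of \<open>X\<close> given \<open>s\<close> bits of memory. The moment
  of order \<open>2 s\<close> of this polynomial bounds the advantage by \<open>O((s / L) ^ (k / 2)) = O((s / n) ^ t)\<close>.
  Summing over the \<open>g \<le> n\<close> flips gives \<open>n (s / n) ^ t = \<Omega>(1)\<close>. The degree \<open>2 t\<close> instead of \<open>t\<close>
  compensates for the union bound over the flips.
\<close>

section \<open>Moments of multilinear polynomials on the cube\<close>

definition bsign :: "'v \<Rightarrow> 'v set \<Rightarrow> real" where
  "bsign u Z = (if u \<in> Z then - 1 else 1)"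

text \<open>Exponents are arbitrary natural numbers rather than 0 or 1, so that multiplying two
  characters just adds exponents.\<close>

definition cube_chars :: "'v set \<Rightarrow> ('v set \<Rightarrow> real) set" where
  "cube_chars R = {\<phi>. \<exists>n. \<forall>Z. \<phi> Z = (\<Prod>u\<in>R. bsign u Z ^ n u)}"

text \<open>The sum factorises over the variables into factors \<open>(- 1) ^ n u + 1\<close>, each
  of them 0 or 2.\<close>

lemma sum_cube_char_nonneg:
  assumes "finite R" "\<phi> \<in> cube_chars R"
  shows "0 \<le> (\<Sum>Z\<in>Pow R. \<phi> Z)"
proof -
  obtain n where n: "\<And>Z. \<phi> Z = (\<Prod>u\<in>R. bsign u Z ^ n u)"
    using assms(2) by (auto simp: cube_chars_def)
  have "(\<Sum>Z\<in>Pow R. \<phi> Z) = (\<Sum>Z\<in>Pow R. (\<Prod>u\<in>Z. (- 1) ^ n u) * (\<Prod>u\<in>R - Z. 1))"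
  proof (rule sum.cong[OF refl])
    fix Z assume "Z \<in> Pow R"
    then have Z: "Z \<subseteq> R" by simp
    have "\<phi> Z = (\<Prod>u\<in>R - Z. bsign u Z ^ n u) * (\<Prod>u\<in>Z. bsign u Z ^ n u)"
      unfolding n by (rule prod.subset_diff[OF Z assms(1)])
    then show "\<phi> Z = (\<Prod>u\<in>Z. (- 1) ^ n u) * (\<Prod>u\<in>R - Z. 1)"
      by (simp add: bsign_def)
  qed
  also have "\<dots> = (\<Prod>u\<in>R. (- 1) ^ n u + (1::real))"
    by (rule prod_add[OF assms(1), symmetric])
  also have "\<dots> \<ge> 0"
    by (intro prod_nonneg ballI) (metis add.right_inverse add_nonneg_nonneg neg_one_even_power neg_one_odd_power order_refl zero_le_one add.commute)
  finally show ?thesis .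
qed

lemma cube_chars_mult:
  assumes "\<phi> \<in> cube_chars R" "\<psi> \<in> cube_chars R"
  shows "(\<lambda>Z. \<phi> Z * \<psi> Z) \<in> cube_chars R"
proof -
  obtain n m where "\<And>Z. \<phi> Z = (\<Prod>u\<in>R. bsign u Z ^ n u)" "\<And>Z. \<psi> Z = (\<Prod>u\<in>R. bsign u Z ^ m u)"
    using assms by (auto simp: cube_chars_def)
  then show ?thesis
    unfolding cube_chars_def
    by (intro CollectI exI[of _ "\<lambda>u. n u + m u"]) (simp add: power_add prod.distrib)
qed

lemma cube_chars_one: "(\<lambda>Z. 1) \<in> cube_chars R"
  unfolding cube_chars_def by (intro CollectI exI[of _ "\<lambda>u. 0"]) simp

lemma bsign_in_cube_chars:
  assumes "finite R" "u \<in> R"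
  shows "bsign u \<in> cube_chars R"
proof -
  have "bsign u Z = (\<Prod>v\<in>R. bsign v Z ^ (if v = u then 1 else 0))" for Z
  proof -
    have "(\<Prod>v\<in>R. bsign v Z ^ (if v = u then 1 else 0)) = (\<Prod>v\<in>R. if v = u then bsign v Z else 1)"
      by (intro prod.cong) auto
    then show ?thesis using assms by (simp add: prod.delta)
  qed
  then show ?thesis
    unfolding cube_chars_def by (intro CollectI exI[of _ "\<lambda>v. if v = u then 1 else 0"]) blast
qed

lemma prod_bsign_in_cube_chars:
  assumes "finite R" "finite B" "\<And>b. b \<in> B \<Longrightarrow> \<phi> b \<in> R"
  shows "(\<lambda>Z. \<Prod>b\<in>B. bsign (\<phi> b) Z) \<in> cube_chars R"
  using assms(2,3)
proof (induction B rule: finite_induct)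
  case empty
  then show ?case by (simp add: cube_chars_one)
next
  case (insert b B)
  then show ?case
    using cube_chars_mult[OF bsign_in_cube_chars[OF assms(1), of "\<phi> b"], of "\<lambda>Z. \<Prod>b\<in>B. bsign (\<phi> b) Z"]
    by simp
qed

text \<open>Because every character has a nonnegative sum over the cube, expanding the power shows that
  a moment only grows when all coefficients are raised to their largest absolute value.\<close>

lemma abs_sum_power_char_le:
  assumes "finite R" "finite J" "\<phi> \<in> cube_chars R"
    and e: "\<And>l. l \<in> J \<Longrightarrow> e l \<in> cube_chars R" and c: "\<And>l. l \<in> J \<Longrightarrow> \<bar>c l\<bar> \<le> 1"
  shows "\<bar>\<Sum>Z\<in>Pow R. (\<Sum>l\<in>J. c l * e l Z) ^ q * \<phi> Z\<bar> \<le> (\<Sum>Z\<in>Pow R. (\<Sum>l\<in>J. e l Z) ^ q * \<phi> Z)"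
  using assms(3)
proof (induction q arbitrary: \<phi>)
  case 0
  then show ?case using sum_cube_char_nonneg[OF assms(1)] by simp
next
  case (Suc q)
  \<comment> \<open>One factor of the power is expanded and its \<open>e l Z\<close> absorbed into
    the character, which is why \<open>\<phi>\<close> is arbitrary in the induction. The identity
    serves both the coefficients \<open>c\<close> and constant coefficients 1.\<close>
  have step: "(\<Sum>Z\<in>Pow R. (\<Sum>l\<in>J. a l * e l Z) ^ Suc q * \<phi> Z) =
      (\<Sum>l\<in>J. a l * (\<Sum>Z\<in>Pow R. (\<Sum>l\<in>J. a l * e l Z) ^ q * (e l Z * \<phi> Z)))" for a
  proof -
    have "(\<Sum>Z\<in>Pow R. (\<Sum>l\<in>J. a l * e l Z) ^ Suc q * \<phi> Z) =
        (\<Sum>Z\<in>Pow R. \<Sum>l\<in>J. a l * ((\<Sum>l\<in>J. a l * e l Z) ^ q * (e l Z * \<phi> Z)))"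
      by (simp add: sum_distrib_right sum_distrib_left mult_ac)
    also have "\<dots> = (\<Sum>l\<in>J. \<Sum>Z\<in>Pow R. a l * ((\<Sum>l\<in>J. a l * e l Z) ^ q * (e l Z * \<phi> Z)))"
      by (rule sum.swap)
    finally show ?thesis by (simp add: sum_distrib_left)
  qed
  have "\<bar>\<Sum>Z\<in>Pow R. (\<Sum>l\<in>J. c l * e l Z) ^ Suc q * \<phi> Z\<bar> \<le>
      (\<Sum>l\<in>J. \<bar>c l * (\<Sum>Z\<in>Pow R. (\<Sum>l\<in>J. c l * e l Z) ^ q * (e l Z * \<phi> Z))\<bar>)"
    unfolding step[of c] by (rule sum_abs)
  also have "\<dots> \<le> (\<Sum>l\<in>J. 1 * (\<Sum>Z\<in>Pow R. (\<Sum>l\<in>J. e l Z) ^ q * (e l Z * \<phi> Z)))"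
    unfolding abs_mult using Suc c e
    by (intro sum_mono mult_mono Suc.IH cube_chars_mult) auto
  also have "\<dots> = (\<Sum>Z\<in>Pow R. (\<Sum>l\<in>J. e l Z) ^ Suc q * \<phi> Z)"
    using step[of "\<lambda>_. 1"] by simp
  finally show ?case .
qed

text \<open>For \<open>j < q\<close>, passing to \<open>Suc j\<close> multiplies the left side by
  the growth factor \<open>(q - j) / (j + 1)\<close> of \<open>q choose j\<close> and by
  \<open>(2 * q - 2 * j - 1) / (2 * j + 1)\<close>, which is at most \<open>2 * q\<close>.\<close>

lemma binomial_double_le: "(2 * q choose (2 * j)) \<le> (q choose j) * (2 * q) ^ j"
proof (induction j)
  case 0
  then show ?case by simp
next
  case (Suc j)
  have absorb: "Suc m * (n choose Suc m) = (n - m) * (n choose m)" for n m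
    using times_binomial_minus1_eq[of "Suc m" n] binomial_absorb_comp[of n m] by simp
  define C where "C = (2 * q choose (2 * j))"
  define C' where "C' = (2 * q choose (2 * Suc j))"
  define D where "D = (q choose j)"
  define D' where "D' = (q choose Suc j)"
  define y where "y = (2 * q) ^ j"
  have IH: "C \<le> D * y" using Suc.IH by (simp add: C_def D_def y_def)
  have A: "(2 * j + 2) * ((2 * j + 1) * C') = (2 * q - (2 * j + 1)) * ((2 * q - 2 * j) * C)"
  proof -
    have 1: "(2 * j + 1) * (2 * q choose (2 * j + 1)) = (2 * q - 2 * j) * C"
      using absorb[of "2 * j" "2 * q"] by (simp add: C_def)
    have 2: "(2 * j + 2) * C' = (2 * q - (2 * j + 1)) * (2 * q choose (2 * j + 1))"
      using absorb[of "2 * j + 1" "2 * q"] by (simp add: C'_def)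
    show ?thesis unfolding 1[symmetric] using 2 by (metis mult.left_commute)
  qed
  have B: "(j + 1) * D' = (q - j) * D" using absorb[of j q] by (simp add: D_def D'_def)
  have "(2 * j + 2) * ((2 * j + 1) * C') \<le> (2 * q) * ((2 * q - 2 * j) * (D * y))"
    unfolding A using IH by (intro mult_le_mono) auto
  also have "\<dots> = (2 * j + 2) * (D' * (2 * q * y))"
    using arg_cong[OF B, of "\<lambda>z. 2 * (2 * q * (y * z))"] by (simp add: algebra_simps)
  also have "\<dots> \<le> (2 * j + 2) * ((2 * j + 1) * (D' * (2 * q * y)))"
    by (intro mult_le_mono2) simp
  finally have "C' \<le> D' * (2 * q * y)"
    by (simp only: mult_le_cancel1)
  then show ?case by (simp add: C'_def D'_def y_def)
qed

text \<open>The odd terms of the two binomial expansions cancel. This is the effect of summing over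
  one random sign.\<close>

lemma power_add_one_diff_one:
  fixes a :: real
  shows "(a + 1) ^ (2 * q) + (a - 1) ^ (2 * q) = (\<Sum>j\<le>q. 2 * real (2 * q choose (2 * j)) * a ^ (2 * (q - j)))"
proof -
  define F where "F i = real (2 * q choose i) * a ^ (2 * q - i) * (1 + (- 1) ^ i)" for i
  have "(a + 1) ^ (2 * q) + (a - 1) ^ (2 * q) = (1 + a) ^ (2 * q) + (- 1 + a) ^ (2 * q)"
    by (simp add: add.commute)
  also have "\<dots> = (\<Sum>i\<le>2 * q. F i)"
    unfolding binomial_ring F_def by (simp add: sum.distrib[symmetric] algebra_simps)
  also have "\<dots> = (\<Sum>i\<in>(\<lambda>j. 2 * j) ` {..q}. F i)"
  proof (rule sum.mono_neutral_right)
    show "\<forall>i\<in>{..2 * q} - (\<lambda>j. 2 * j) ` {..q}. F i = 0"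
    proof
      fix i assume i: "i \<in> {..2 * q} - (\<lambda>j. 2 * j) ` {..q}"
      have "odd i"
      proof
        assume "even i"
        then obtain j where "i = 2 * j" by (elim evenE)
        with i show False by auto
      qed
      then show "F i = 0" by (simp add: F_def)
    qed
  qed auto
  also have "\<dots> = (\<Sum>j\<le>q. F (2 * j))"
    by (subst sum.reindex) (auto simp: inj_on_def)
  also have "\<dots> = (\<Sum>j\<le>q. 2 * real (2 * q choose (2 * j)) * a ^ (2 * (q - j)))"
    by (intro sum.cong) (auto simp: F_def right_diff_distrib')
  finally show ?thesis .
qed

lemma sum_Pow_insert:
  assumes "finite R" "u \<notin> R"
  shows "(\<Sum>Z\<in>Pow (insert u R). h Z) = (\<Sum>Z\<in>Pow R. h Z + h (insert u Z))"
proof -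
  have "(\<Sum>Z\<in>Pow (insert u R). h Z) = (\<Sum>Z\<in>Pow R. h Z) + (\<Sum>Z\<in>insert u ` Pow R. h Z)"
    unfolding Pow_insert using assms by (intro sum.union_disjoint) auto
  also have "(\<Sum>Z\<in>insert u ` Pow R. h Z) = (\<Sum>Z\<in>Pow R. h (insert u Z))"
    using assms(2) by (intro sum.reindex_cong[of "insert u"]) (auto simp: inj_on_def)
  finally show ?thesis by (simp add: sum.distrib)
qed

text \<open>A Khintchine-type bound. Summing over one sign leaves even moments of the remaining sum,
  and \<open>binomial_double_le\<close> compares the result with the binomial expansion of
  \<open>(2 * Q + 2 * Q * card R) ^ q\<close>. The cap \<open>Q\<close> keeps the base the same for
  all smaller exponents in the induction hypothesis.\<close>

lemma rademacher_moment_le: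
  assumes "finite R" "q \<le> Q"
  shows "(\<Sum>Z\<in>Pow R. (\<Sum>u\<in>R. bsign u Z) ^ (2 * q)) \<le> 2 ^ card R * (2 * real Q * real (card R)) ^ q"
  using assms
proof (induction R arbitrary: q rule: finite_induct)
  case empty
  then show ?case by (cases q) auto
next
  case (insert u R)
  define S where "S Z = (\<Sum>v\<in>R. bsign v Z)" for Z
  have S_insert: "S (insert u Z) = S Z" for Z
    unfolding S_def using insert.hyps by (intro sum.cong) (auto simp: bsign_def)
  have "(\<Sum>Z\<in>Pow (insert u R). (\<Sum>v\<in>insert u R. bsign v Z) ^ (2 * q)) =
      (\<Sum>Z\<in>Pow (insert u R). (bsign u Z + S Z) ^ (2 * q))"
    using insert.hyps by (simp add: S_def)
  also have "\<dots> = (\<Sum>Z\<in>Pow R. (bsign u Z + S Z) ^ (2 * q) + (bsign u (insert u Z) + S (insert u Z)) ^ (2 * q))"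
    by (rule sum_Pow_insert[OF insert.hyps])
  also have "\<dots> = (\<Sum>Z\<in>Pow R. (S Z + 1) ^ (2 * q) + (S Z - 1) ^ (2 * q))"
    using insert.hyps by (intro sum.cong) (auto simp: bsign_def S_insert add.commute)
  also have "\<dots> = (\<Sum>j\<le>q. 2 * real (2 * q choose (2 * j)) * (\<Sum>Z\<in>Pow R. S Z ^ (2 * (q - j))))"
    unfolding power_add_one_diff_one sum_distrib_left by (rule sum.swap)
  also have "\<dots> \<le> (\<Sum>j\<le>q. 2 * (real (q choose j) * (2 * real Q) ^ j) *
      (2 ^ card R * (2 * real Q * real (card R)) ^ (q - j)))"
  proof (rule sum_mono)
    fix j assume "j \<in> {..q}"
    have "real (2 * q choose (2 * j)) \<le> real (q choose j) * (2 * real q) ^ j"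
      using of_nat_mono[OF binomial_double_le[of q j], where 'a=real] by simp
    also have "\<dots> \<le> real (q choose j) * (2 * real Q) ^ j"
      using insert.prems by (intro mult_left_mono power_mono) auto
    finally have 1: "2 * real (2 * q choose (2 * j)) \<le> 2 * (real (q choose j) * (2 * real Q) ^ j)" by simp
    have 2: "(\<Sum>Z\<in>Pow R. S Z ^ (2 * (q - j))) \<le> 2 ^ card R * (2 * real Q * real (card R)) ^ (q - j)"
      using insert.IH[of "q - j"] insert.prems by (simp add: S_def)
    show "2 * real (2 * q choose (2 * j)) * (\<Sum>Z\<in>Pow R. S Z ^ (2 * (q - j))) \<le>
        2 * (real (q choose j) * (2 * real Q) ^ j) * (2 ^ card R * (2 * real Q * real (card R)) ^ (q - j))"
      by (rule mult_mono[OF 1 2]) (auto intro!: sum_nonneg simp: power_mult)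
  qed
  also have "\<dots> = 2 * 2 ^ card R * (2 * real Q + 2 * real Q * real (card R)) ^ q"
    unfolding binomial_ring sum_distrib_left by (intro sum.cong) auto
  finally show ?case using insert.hyps by (simp add: algebra_simps)
qed

text \<open>Each monomial is a \<open>k\<close>-tuple of variables of \<open>R\<close>. With missing
  tuples added and all coefficients raised to 1, the polynomial becomes the \<open>k\<close>-th
  power of the sum of all signs, so its moment of order \<open>2 * r\<close> is a moment of order
  \<open>2 * r * k\<close> of that sum.\<close>

lemma multilinear_moment_le:
  fixes \<pi> :: "nat \<times> nat \<Rightarrow> 'v"
  assumes "finite U" "inj_on \<pi> (U \<times> {..<k})"
    and R: "R = \<pi> ` (U \<times> {..<k})"
    and c: "\<And>l. l \<in> {..<k} \<rightarrow>\<^sub>E U \<Longrightarrow> \<bar>c l\<bar> \<le> 1"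
  shows "(\<Sum>Z\<in>Pow R. (\<Sum>l\<in>{..<k} \<rightarrow>\<^sub>E U. c l * (\<Prod>b<k. bsign (\<pi> (l b, b)) Z)) ^ (2 * r))
    \<le> 2 ^ card R * (2 * real (r * k) * real (card R)) ^ (r * k)"
proof -
  define I where "I = ({..<k} \<rightarrow>\<^sub>E U)"
  define J where "J = ({..<k} \<rightarrow>\<^sub>E R)"
  define \<psi> where "\<psi> l = restrict (\<lambda>b. \<pi> (l b, b)) {..<k}" for l :: "nat \<Rightarrow> nat"
  define e where "e j Z = (\<Prod>b<k. bsign (j b) Z)" for j :: "nat \<Rightarrow> 'v" and Z
  \<comment> \<open>Tuples that do not take their entry \<open>b\<close> from column
    \<open>b\<close> receive coefficient 0, which still has absolute value at most 1.\<close>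
  define d where "d j = (if j \<in> \<psi> ` I then c (inv_into I \<psi> j) else 0)" for j
  have finR: "finite R" using assms(1) R by simp
  have finJ: "finite J" unfolding J_def using finR by (intro finite_PiE) auto
  have \<psi>J: "\<psi> ` I \<subseteq> J" unfolding \<psi>_def I_def J_def R by (auto simp: PiE_iff)
  have inj: "inj_on \<psi> I"
  proof (rule inj_onI)
    fix l l' assume l: "l \<in> I" "l' \<in> I" and eq: "\<psi> l = \<psi> l'"
    show "l = l'"
    proof (rule PiE_ext[OF l[unfolded I_def]])
      fix b assume b: "b \<in> {..<k}"
      have "\<pi> (l b, b) = \<pi> (l' b, b)" using fun_cong[OF eq, of b] b by (simp add: \<psi>_def)
      moreover have "(l b, b) \<in> U \<times> {..<k}" "(l' b, b) \<in> U \<times> {..<k}"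
        using l b by (auto simp: I_def PiE_iff)
      ultimately show "l b = l' b" using assms(2) by (auto dest: inj_onD)
    qed
  qed
  have lhs: "(\<Sum>l\<in>I. c l * (\<Prod>b<k. bsign (\<pi> (l b, b)) Z)) = (\<Sum>j\<in>J. d j * e j Z)" for Z
  proof -
    have "(\<Sum>j\<in>J. d j * e j Z) = (\<Sum>j\<in>\<psi> ` I. d j * e j Z)"
      using finJ \<psi>J by (intro sum.mono_neutral_right) (auto simp: d_def)
    also have "\<dots> = (\<Sum>l\<in>I. c l * (\<Prod>b<k. bsign (\<pi> (l b, b)) Z))"
      unfolding sum.reindex[OF inj]
    proof (rule sum.cong[OF refl])
      fix l assume l: "l \<in> I"
      have "e (\<psi> l) Z = (\<Prod>b<k. bsign (\<pi> (l b, b)) Z)" by (simp add: e_def \<psi>_def)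
      then show "((\<lambda>j. d j * e j Z) \<circ> \<psi>) l = c l * (\<Prod>b<k. bsign (\<pi> (l b, b)) Z)"
        using l inj by (simp add: d_def)
    qed
    finally show ?thesis by simp
  qed
  have "(\<Sum>Z\<in>Pow R. (\<Sum>l\<in>I. c l * (\<Prod>b<k. bsign (\<pi> (l b, b)) Z)) ^ (2 * r)) \<le>
      \<bar>\<Sum>Z\<in>Pow R. (\<Sum>j\<in>J. d j * e j Z) ^ (2 * r) * 1\<bar>"
    unfolding lhs by simp
  also have "\<dots> \<le> (\<Sum>Z\<in>Pow R. (\<Sum>j\<in>J. e j Z) ^ (2 * r) * 1)"
  proof (rule abs_sum_power_char_le[OF finR finJ cube_chars_one])
    show "e j \<in> cube_chars R" if "j \<in> J" for j
      unfolding e_def using that by (intro prod_bsign_in_cube_chars finR) (auto simp: J_def)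
    show "\<bar>d j\<bar> \<le> 1" for j
      unfolding d_def using inj c by (auto simp: I_def)
  qed
  also have "\<dots> = (\<Sum>Z\<in>Pow R. (\<Sum>u\<in>R. bsign u Z) ^ (2 * (r * k)))"
  proof (rule sum.cong[OF refl])
    fix Z
    have "(\<Sum>j\<in>J. e j Z) = (\<Prod>b<k. \<Sum>u\<in>R. bsign u Z)"
      unfolding J_def e_def using finR by (subst prod_sum_PiE) auto
    then have "(\<Sum>j\<in>J. e j Z) ^ (2 * r) = (\<Sum>u\<in>R. bsign u Z) ^ (k * (2 * r))"
      by (simp add: power_mult)
    also have "k * (2 * r) = 2 * (r * k)" by simp
    finally show "(\<Sum>j\<in>J. e j Z) ^ (2 * r) * 1 = (\<Sum>u\<in>R. bsign u Z) ^ (2 * (r * k))" by simp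
  qed
  also have "\<dots> \<le> 2 ^ card R * (2 * real (r * k) * real (card R)) ^ (r * k)"
    by (rule rademacher_moment_le[OF finR order_refl])
  finally show ?thesis unfolding I_def .
qed

section \<open>Flipping one gadget\<close>

definition row_char :: "nat \<Rightarrow> (nat \<times> nat \<Rightarrow> 'v) \<Rightarrow> nat \<Rightarrow> 'v set \<Rightarrow> real" where
  "row_char k \<pi> j X = (\<Prod>b<k. bsign (\<pi> (j, b)) X)"

text \<open>Gadgets before \<open>i\<close> carry their true parity, the later ones the negated
  parity. Bits from row \<open>g\<close> on are fixed to \<open>False\<close>, so that the whole
  function does not depend on the variables of those rows.\<close>

definition hybrid :: "nat \<Rightarrow> nat \<Rightarrow> nat \<Rightarrow> (nat \<times> nat \<Rightarrow> 'v) \<Rightarrow> 'v set \<Rightarrow> nat \<Rightarrow> bool" where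
  "hybrid g k i \<pi> X j \<longleftrightarrow> j < g \<and> (row_char k \<pi> j X = - 1 \<longleftrightarrow> j < i)"

text \<open>Every column has its own transposition, so composing with these maps turns row
  \<open>i\<close> into any choice of one entry per column.\<close>

definition swap_rows :: "nat \<Rightarrow> nat \<Rightarrow> (nat \<Rightarrow> nat) \<Rightarrow> nat \<times> nat \<Rightarrow> nat \<times> nat" where
  "swap_rows k i l = (\<lambda>(j, b). if b < k then (Transposition.transpose i (l b) j, b) else (j, b))"

lemma row_char_cases: "row_char k \<pi> j X = 1 \<or> row_char k \<pi> j X = - 1"
  unfolding row_char_def by (induction k) (auto simp: bsign_def)

lemma swap_rows_permutes:
  assumes "i < m" "\<And>b. b < k \<Longrightarrow> l b < m"
  shows "swap_rows k i l permutes ({..<m} \<times> {..<k})"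
proof -
  have inv: "swap_rows k i l (swap_rows k i l x) = x" for x
    by (cases x) (simp add: swap_rows_def)
  show ?thesis
    unfolding permutes_def
  proof (intro conjI allI impI)
    fix x :: "nat \<times> nat"
    assume x: "x \<notin> {..<m} \<times> {..<k}"
    obtain j b where jb: "x = (j, b)" by (cases x)
    show "swap_rows k i l x = x"
      using x assms jb by (auto simp: swap_rows_def Transposition.transpose_def)
  next
    fix y
    show "\<exists>!x. swap_rows k i l x = y" using inv by metis
  qed
qed

lemma sum_Pow_split:
  assumes "finite V" "R \<subseteq> V"
  shows "(\<Sum>X\<in>Pow V. h X) = (\<Sum>Y\<in>Pow (V - R). \<Sum>Z\<in>Pow R. h (Y \<union> Z))"
  unfolding sum.cartesian_product
  using assms(2)
  by (intro sum.reindex_bij_witness[of _ "\<lambda>(Y, Z). Y \<union> Z" "\<lambda>X. (X - R, X \<inter> R)"])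
     (auto simp: Un_Diff Int_Un_distrib2 intro!: arg_cong[of _ _ h])

text \<open>A truncation at level \<open>d\<close>. It is linear in the power, so an average
  weighted by \<open>f\<close> can be bounded by an unweighted moment.\<close>

lemma abs_le_add_power:
  fixes x :: real
  assumes "d > 0" "r > 0"
  shows "\<bar>x\<bar> \<le> d + d * (x / d) ^ (2 * r)"
proof (cases "\<bar>x\<bar> \<le> d")
  case True
  then show ?thesis using assms by (simp add: power_mult add_increasing2)
next
  case False
  then have "1 \<le> \<bar>x / d\<bar>" using assms by simp
  then have "\<bar>x / d\<bar> ^ 1 \<le> \<bar>x / d\<bar> ^ (2 * r)" using assms by (intro power_increasing) auto
  then have "\<bar>x / d\<bar> \<le> (x / d) ^ (2 * r)" by (simp add: power_even_abs del: abs_divide)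
  then have "d * \<bar>x / d\<bar> \<le> d * (x / d) ^ (2 * r)" using assms by (intro mult_left_mono) auto
  moreover have "d * \<bar>x / d\<bar> = \<bar>x\<bar>" using assms by simp
  ultimately show ?thesis using assms by simp
qed

text \<open>Only bit \<open>i\<close> changes, from the negated parity to the parity. Pulling out
  the sign leaves a factor in which bit \<open>i\<close> is overwritten by constants and which
  therefore no longer reads row \<open>i\<close>.\<close>

lemma hybrid_diff_eq:
  assumes "i < g"
  shows "F (hybrid g k (Suc i) \<pi> X) - F (hybrid g k i \<pi> X) =
    row_char k \<pi> i X * (F ((hybrid g k i \<pi> X)(i := False)) - F ((hybrid g k i \<pi> X)(i := True)) :: real)"
proof -
  have 1: "hybrid g k (Suc i) \<pi> X = (hybrid g k i \<pi> X)(i := row_char k \<pi> i X = - 1)"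
    using assms by (auto simp: hybrid_def fun_eq_iff)
  have 2: "(hybrid g k i \<pi> X)(i := row_char k \<pi> i X \<noteq> - 1) = hybrid g k i \<pi> X"
    using assms by (auto simp: hybrid_def fun_eq_iff)
  show ?thesis
  proof (cases "row_char k \<pi> i X = - 1")
    case True
    then show ?thesis using 1 2 by simp
  next
    case False
    then have "row_char k \<pi> i X = 1" using row_char_cases[of k \<pi> i X] by simp
    then show ?thesis using 1 2 by simp
  qed
qed

text \<open>Conditioned on everything that the other gadgets read, row \<open>i\<close> of a random permutation is
  still spread over all unused variables. Composing the permutation with the row swaps makes this
  average explicit.\<close>

lemma hybrid_step:
  fixes f :: "'s \<Rightarrow> (nat \<times> nat) set \<Rightarrow> real"
    and G :: "'s \<Rightarrow> (nat \<times> nat \<Rightarrow> nat \<times> nat) \<Rightarrow> (nat \<Rightarrow> bool) \<Rightarrow> real"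
  assumes i: "i < g" and L: "L > 0" and r: "r > 0" and t: "t > 0" and k: "k = 2 * t"
    and V: "V = {..<g + L} \<times> {..<k}"
    and S: "finite S" "card S \<le> 2 ^ (2 * r)"
    and f0: "\<And>\<sigma> X. 0 \<le> f \<sigma> X" and f1: "\<And>X. X \<subseteq> V \<Longrightarrow> (\<Sum>\<sigma>\<in>S. f \<sigma> X) \<le> 1" and f1': "\<And>\<sigma> X. f \<sigma> X \<le> 1"
    and G0: "\<And>\<sigma> \<pi> w. 0 \<le> G \<sigma> \<pi> w" and G1: "\<And>\<sigma> \<pi> w. G \<sigma> \<pi> w \<le> 1"
  shows "(\<Sum>\<pi> | \<pi> permutes V. \<Sum>X\<in>Pow V. \<Sum>\<sigma>\<in>S.
      f \<sigma> X * (G \<sigma> \<pi> (hybrid g k (Suc i) \<pi> X) - G \<sigma> \<pi> (hybrid g k i \<pi> X)))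
    \<le> real (card {\<pi>. \<pi> permutes V}) * 2 ^ card V * (4 * (2 * real r * (real k)\<^sup>2 / real L) ^ t)"
proof -
  define I where "I = ({..<k} \<rightarrow>\<^sub>E {g..<g + L})"
  define \<Delta> where "\<Delta> \<sigma> \<pi> X = G \<sigma> \<pi> ((hybrid g k i \<pi> X)(i := False)) - G \<sigma> \<pi> ((hybrid g k i \<pi> X)(i := True))"
    for \<sigma> \<pi> X
  define T where "T \<pi> = (\<Sum>X\<in>Pow V. \<Sum>\<sigma>\<in>S. f \<sigma> X * (row_char k \<pi> i X * \<Delta> \<sigma> \<pi> X))" for \<pi>
  define Q where "Q \<sigma> \<pi> X = (\<Sum>l\<in>I. \<Delta> \<sigma> (\<pi> \<circ> swap_rows k i l) X * (\<Prod>b<k. bsign (\<pi> (l b, b)) X))" for \<sigma> \<pi> X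
  \<comment> \<open>\<open>B ^ (2 * r)\<close> is the bound of \<open>multilinear_moment_le\<close>
    for \<open>card R = L * k\<close>, because \<open>r * k = t * (2 * r)\<close>.\<close>
  define B where "B = (2 * real r * (real k)\<^sup>2 * real L) ^ t"
  define perms where "perms = {\<pi>. \<pi> permutes V}"
  have finV: "finite V" by (simp add: V)
  have k0: "k > 0" using k t by simp
  have B0: "B > 0" using L r k0 by (simp add: B_def)
  have finI: "finite I" by (simp add: I_def finite_PiE)
  have cardI: "card I = L ^ k" by (simp add: I_def card_PiE)
  have \<Delta>1: "\<bar>\<Delta> \<sigma> \<pi> X\<bar> \<le> 1" for \<sigma> \<pi> X
    unfolding \<Delta>_def using G0[of \<sigma> \<pi>] G1[of \<sigma> \<pi>] by (smt (verit))
  have swap: "swap_rows k i l permutes V" if "l \<in> I" for l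
    unfolding V using that i by (intro swap_rows_permutes) (auto simp: I_def PiE_iff)
  have swap_i: "swap_rows k i l (i, b) = (l b, b)" if "b < k" for l b
    using that by (simp add: swap_rows_def)
  have swap_other: "swap_rows k i l (j, b) = (j, b)" if "l \<in> I" "j < g" "j \<noteq> i" "b < k" for l j b
  proof -
    have "g \<le> l b" using that by (auto simp: I_def PiE_iff)
    then show ?thesis using that by (auto simp: swap_rows_def Transposition.transpose_def)
  qed
  have moment: "(\<Sum>X\<in>Pow V. Q \<sigma> \<pi> X ^ (2 * r)) \<le> 2 ^ card V * B ^ (2 * r)" if \<pi>: "\<pi> \<in> perms" for \<sigma> \<pi>
  proof -
    define R where "R = \<pi> ` ({g..<g + L} \<times> {..<k})"
    have \<pi>V: "\<pi> permutes V" using \<pi> by (simp add: perms_def)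
    have inj: "inj \<pi>" using \<pi>V by (rule permutes_inj)
    have RV: "R \<subseteq> V" 
    proof -
      have "R \<subseteq> \<pi> ` V" unfolding R_def V by (intro image_mono) auto
      then show ?thesis using permutes_image[OF \<pi>V] by simp
    qed
    have finR: "finite R" by (simp add: R_def)
    have cardR: "card R = L * k"
      unfolding R_def by (subst card_image) (auto intro: inj_on_subset[OF inj])
    \<comment> \<open>The swaps move only row \<open>i\<close> among the gadget rows, and
      \<open>\<pi>\<close> sends the other gadget rows outside \<open>R\<close>. Once
      \<open>X - R\<close> is fixed, the coefficients of \<open>Q\<close> are constants.\<close>
    have \<Delta>R: "\<Delta> \<sigma> (\<pi> \<circ> swap_rows k i l) (Y \<union> Z) = \<Delta> \<sigma> (\<pi> \<circ> swap_rows k i l) Y"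
      if l: "l \<in> I" and Z: "Z \<subseteq> R" for l Y Z
    proof -
      have "row_char k (\<pi> \<circ> swap_rows k i l) j (Y \<union> Z) = row_char k (\<pi> \<circ> swap_rows k i l) j Y"
        if j: "j < g" "j \<noteq> i" for j
      proof -
        have "\<pi> (j, b) \<notin> R" if "b < k" for b
        proof
          assume "\<pi> (j, b) \<in> R"
          then obtain a where "a \<in> {g..<g + L} \<times> {..<k}" "\<pi> (j, b) = \<pi> a" by (auto simp: R_def)
          with inj_eq[OF inj] j show False by auto
        qed
        then show ?thesis
          unfolding row_char_def using Z j l
          by (intro prod.cong) (auto simp: swap_other bsign_def)
      qed
      then have "(hybrid g k i (\<pi> \<circ> swap_rows k i l) (Y \<union> Z))(i := v) =
          (hybrid g k i (\<pi> \<circ> swap_rows k i l) Y)(i := v)" for v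
        by (auto simp: hybrid_def fun_eq_iff)
      then show ?thesis by (simp add: \<Delta>_def)
    qed
    have "(\<Sum>X\<in>Pow V. Q \<sigma> \<pi> X ^ (2 * r)) = (\<Sum>Y\<in>Pow (V - R). \<Sum>Z\<in>Pow R. Q \<sigma> \<pi> (Y \<union> Z) ^ (2 * r))"
      by (rule sum_Pow_split[OF finV RV])
    also have "\<dots> \<le> (\<Sum>Y\<in>Pow (V - R). 2 ^ card R * B ^ (2 * r))"
    proof (rule sum_mono)
      fix Y assume Y: "Y \<in> Pow (V - R)"
      have "(\<Sum>Z\<in>Pow R. Q \<sigma> \<pi> (Y \<union> Z) ^ (2 * r)) =
          (\<Sum>Z\<in>Pow R. (\<Sum>l\<in>I. \<Delta> \<sigma> (\<pi> \<circ> swap_rows k i l) Y * (\<Prod>b<k. bsign (\<pi> (l b, b)) Z)) ^ (2 * r))"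
      proof (rule sum.cong[OF refl])
        fix Z assume Z: "Z \<in> Pow R"
        have "(\<Prod>b<k. bsign (\<pi> (l b, b)) (Y \<union> Z)) = (\<Prod>b<k. bsign (\<pi> (l b, b)) Z)" if l: "l \<in> I" for l
        proof (rule prod.cong[OF refl])
          fix b assume "b \<in> {..<k}"
          then have "\<pi> (l b, b) \<in> R" using l by (auto simp: R_def I_def PiE_iff)
          then show "bsign (\<pi> (l b, b)) (Y \<union> Z) = bsign (\<pi> (l b, b)) Z"
            using Y by (auto simp: bsign_def)
        qed
        then have "Q \<sigma> \<pi> (Y \<union> Z) = (\<Sum>l\<in>I. \<Delta> \<sigma> (\<pi> \<circ> swap_rows k i l) Y * (\<Prod>b<k. bsign (\<pi> (l b, b)) Z))"
          unfolding Q_def using Z by (intro sum.cong) (auto simp: \<Delta>R)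
        then show "Q \<sigma> \<pi> (Y \<union> Z) ^ (2 * r) =
          (\<Sum>l\<in>I. \<Delta> \<sigma> (\<pi> \<circ> swap_rows k i l) Y * (\<Prod>b<k. bsign (\<pi> (l b, b)) Z)) ^ (2 * r)" by simp
      qed
      also have "\<dots> \<le> 2 ^ card R * (2 * real (r * k) * real (card R)) ^ (r * k)"
        unfolding I_def
        by (rule multilinear_moment_le) (auto simp: R_def \<Delta>1 intro: inj_on_subset[OF inj])
      also have "(2 * real (r * k) * real (card R)) ^ (r * k) = B ^ (2 * r)"
      proof -
        have "2 * real (r * k) * real (card R) = 2 * real r * (real k)\<^sup>2 * real L"
          by (simp add: cardR power2_eq_square)
        moreover have "r * k = t * (2 * r)" by (simp add: k)
        ultimately show ?thesis unfolding B_def by (simp only: power_mult)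
      qed
      finally show "(\<Sum>Z\<in>Pow R. Q \<sigma> \<pi> (Y \<union> Z) ^ (2 * r)) \<le> 2 ^ card R * B ^ (2 * r)" .
    qed
    also have "\<dots> = 2 ^ (card (V - R) + card R) * B ^ (2 * r)"
      using finV by (simp add: card_Pow power_add)
    also have "card (V - R) + card R = card V"
      using RV finV by (metis add.commute card_Diff_subset card_mono finR le_add_diff_inverse)
    finally show ?thesis .
  qed
  have T_swap: "T (\<pi> \<circ> swap_rows k i l) = (\<Sum>X\<in>Pow V. \<Sum>\<sigma>\<in>S. f \<sigma> X *
      (\<Delta> \<sigma> (\<pi> \<circ> swap_rows k i l) X * (\<Prod>b<k. bsign (\<pi> (l b, b)) X)))" for \<pi> l
    unfolding T_def by (simp add: row_char_def swap_i mult_ac)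
  \<comment> \<open>Composition with each of the \<open>L ^ k\<close> swaps permutes the index set
    of the sum, so the sum equals its average over all swaps.\<close>
  have "real (L ^ k) * (\<Sum>\<pi>\<in>perms. T \<pi>) = (\<Sum>l\<in>I. \<Sum>\<pi>\<in>perms. T \<pi>)"
    by (simp add: cardI)
  also have "\<dots> = (\<Sum>l\<in>I. \<Sum>\<pi>\<in>perms. T (\<pi> \<circ> swap_rows k i l))"
    unfolding perms_def by (intro sum.cong refl sum_permutations_compose_right swap)
  also have "\<dots> = (\<Sum>\<pi>\<in>perms. \<Sum>l\<in>I. T (\<pi> \<circ> swap_rows k i l))"
    by (rule sum.swap)
  also have "\<dots> = (\<Sum>\<pi>\<in>perms. \<Sum>X\<in>Pow V. \<Sum>\<sigma>\<in>S. f \<sigma> X * Q \<sigma> \<pi> X)"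
    unfolding T_swap Q_def sum_distrib_left
    by (subst sum.swap[of _ _ I], subst sum.swap[of _ _ I]) (rule refl)
  also have "\<dots> \<le> (\<Sum>\<pi>\<in>perms. 2 ^ card V * (4 * B))"
  proof (rule sum_mono)
    fix \<pi> assume \<pi>: "\<pi> \<in> perms"
    \<comment> \<open>Truncating at \<open>2 * B\<close> instead of \<open>B\<close> gains
      \<open>2 ^ (2 * r)\<close> in the moment term, which pays for the sum over all memory states
      in \<open>S\<close>. The first term keeps its weight \<open>f\<close>, with total mass at most
      1; the second uses only \<open>f \<le> 1\<close>.\<close>
    have "(\<Sum>X\<in>Pow V. \<Sum>\<sigma>\<in>S. f \<sigma> X * Q \<sigma> \<pi> X) \<le>
        (\<Sum>X\<in>Pow V. \<Sum>\<sigma>\<in>S. f \<sigma> X * (2 * B) + 2 * B * (Q \<sigma> \<pi> X / (2 * B)) ^ (2 * r))"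
    proof (intro sum_mono)
      fix X \<sigma>
      have "f \<sigma> X * Q \<sigma> \<pi> X \<le> f \<sigma> X * (2 * B + 2 * B * (Q \<sigma> \<pi> X / (2 * B)) ^ (2 * r))"
        using abs_le_add_power[of "2 * B" r "Q \<sigma> \<pi> X"] B0 r f0[of \<sigma> X] by (intro mult_left_mono) auto
      also have "\<dots> \<le> f \<sigma> X * (2 * B) + 1 * (2 * B * (Q \<sigma> \<pi> X / (2 * B)) ^ (2 * r))"
        unfolding distrib_left using f1'[of \<sigma> X] B0
        by (intro add_left_mono mult_right_mono) (auto simp: power_mult)
      finally show "f \<sigma> X * Q \<sigma> \<pi> X \<le> f \<sigma> X * (2 * B) + 2 * B * (Q \<sigma> \<pi> X / (2 * B)) ^ (2 * r)" by simp
    qed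
    also have "\<dots> = (\<Sum>X\<in>Pow V. (\<Sum>\<sigma>\<in>S. f \<sigma> X) * (2 * B)) +
        (\<Sum>\<sigma>\<in>S. 2 * B / (2 * B) ^ (2 * r) * (\<Sum>X\<in>Pow V. Q \<sigma> \<pi> X ^ (2 * r)))"
      unfolding sum.distrib sum_distrib_right sum_distrib_left
      by (simp add: power_divide sum.swap[of _ S "Pow V"])
    also have "\<dots> \<le> (\<Sum>X\<in>Pow V. 1 * (2 * B)) +
        (\<Sum>\<sigma>\<in>S. 2 * B / (2 * B) ^ (2 * r) * (2 ^ card V * B ^ (2 * r)))"
      using B0 f1 moment[OF \<pi>] by (intro add_mono sum_mono mult_right_mono mult_left_mono) auto
    also have "\<dots> = 2 ^ card V * (2 * B) + 2 ^ card V * (2 * B) * (real (card S) / 2 ^ (2 * r))"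
      using B0 finV by (simp add: card_Pow power_mult_distrib)
    also have "\<dots> \<le> 2 ^ card V * (2 * B) + 2 ^ card V * (2 * B) * 1"
    proof -
      have "real (card S) \<le> 2 ^ (2 * r)" using S(2) by (metis of_nat_le_iff of_nat_numeral of_nat_power)
      then show ?thesis using B0 by (intro add_left_mono mult_left_mono) auto
    qed
    finally show "(\<Sum>X\<in>Pow V. \<Sum>\<sigma>\<in>S. f \<sigma> X * Q \<sigma> \<pi> X) \<le> 2 ^ card V * (4 * B)" by (simp add: mult_ac)
  qed
  also have "\<dots> = real (L ^ k) * (real (card perms) * 2 ^ card V * (4 * (2 * real r * (real k)\<^sup>2 / real L) ^ t))"
  proof -
    \<comment> \<open>As \<open>k = 2 * t\<close>, the number of swaps is
      \<open>(L * L) ^ t\<close>; dividing by it turns the factor \<open>L\<close> inside the power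
      into \<open>1 / L\<close>.\<close>
    have "B = real (L ^ k) * (2 * real r * (real k)\<^sup>2 / real L) ^ t"
    proof -
      have "(2 * real r * (real k)\<^sup>2 * real L) = real L * real L * (2 * real r * (real k)\<^sup>2 / real L)"
        using L by simp
      then have "B = (real L * real L) ^ t * (2 * real r * (real k)\<^sup>2 / real L) ^ t"
        unfolding B_def by (simp only: power_mult_distrib)
      also have "(real L * real L) ^ t = real (L ^ k)"
        by (simp add: k power_mult power2_eq_square)
      finally show ?thesis .
    qed
    then show ?thesis by simp
  qed
  finally have "(\<Sum>\<pi>\<in>perms. T \<pi>) \<le> real (card perms) * 2 ^ card V * (4 * (2 * real r * (real k)\<^sup>2 / real L) ^ t)"
    using L by simp
  then show ?thesis
    unfolding T_def \<Delta>_def perms_def hybrid_diff_eq[OF i, of "G _ _", symmetric] .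
qed

section \<open>The graphs\<close>

lemma is_cycle_edge:
  assumes "is_cycle E vs" "i < length vs"
  shows "{vs ! i, vs ! (Suc i mod length vs)} \<in> E"
proof (cases "Suc i < length vs")
  case True
  then show ?thesis using assms by (simp add: is_cycle_def)
next
  case False
  then have "Suc i = length vs" using assms by simp
  then have "i = length vs - 1" "Suc i mod length vs = 0" "vs \<noteq> []"
    by auto
  then show ?thesis using assms by (simp add: is_cycle_def last_conv_nth hd_conv_nth)
qed

text \<open>On a cycle the highest vertex would have two distinct parents.\<close>

lemma cycle_free_if_parent:
  fixes enc :: "'a \<Rightarrow> nat" and par :: "'a \<Rightarrow> 'a" and h :: "'a \<Rightarrow> nat"
  assumes inj: "inj_on enc W"
    and E: "\<And>e. e \<in> E \<Longrightarrow> \<exists>v\<in>W. par v \<in> W \<and> e = {enc v, enc (par v)} \<and> h (par v) < h v"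
  shows "cycle_free E"
  unfolding cycle_free_def
proof
  assume "\<exists>vs. is_cycle E vs"
  then obtain vs where cyc: "is_cycle E vs" ..
  define n where "n = length vs"
  have n: "n \<ge> 3" and dist: "distinct vs" using cyc by (auto simp: is_cycle_def n_def)
  define H where "H x = h (inv_into W enc x)" for x
  have H: "H (enc v) = h v" if "v \<in> W" for v using inj that by (simp add: H_def)
  \<comment> \<open>A neighbour that is not higher than \<open>x\<close> must be its parent, so
    \<open>x\<close> determines it.\<close>
  have parent: "\<exists>v\<in>W. x = enc v \<and> y = enc (par v)" if "{x, y} \<in> E" "H y \<le> H x" for x y
    using E[OF that(1)] that(2) H by (fastforce simp: doubleton_eq_iff)
  define m where "m = Max ((\<lambda>i. H (vs ! i)) ` {..<n})"
  have "m \<in> (\<lambda>i. H (vs ! i)) ` {..<n}" 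
  proof -
    have "0 \<in> {..<n}" using n by simp
    then show ?thesis unfolding m_def by (intro Max_in) blast+
  qed
  then obtain i where i: "i < n" "m = H (vs ! i)" by auto
  have max: "H (vs ! j) \<le> H (vs ! i)" if "j < n" for j
    unfolding i(2)[symmetric] m_def using that by (intro Max_ge) auto
  \<comment> \<open>The positions after and before \<open>i\<close> on the cycle; they differ
    because the length is at least 3.\<close>
  define a where "a = Suc i mod n"
  define b where "b = (if i = 0 then n - 1 else i - 1)"
  have ab: "a < n" "b < n" using n i by (auto simp: a_def b_def)
  have "a \<noteq> b"
  proof (cases "Suc i < n")
    case True
    then show ?thesis using n by (auto simp: a_def b_def)
  next
    case False
    then have "Suc i = n" using i by simp
    then show ?thesis using n by (auto simp: a_def b_def)
  qed
  then have ne: "vs ! a \<noteq> vs ! b"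
    using dist ab by (simp add: nth_eq_iff_index_eq n_def)
  have "Suc b mod n = i" using n i by (auto simp: b_def)
  then have "{vs ! i, vs ! a} \<in> E" "{vs ! i, vs ! b} \<in> E"
    using is_cycle_edge[OF cyc, of i] is_cycle_edge[OF cyc, of b] i ab
    by (simp_all add: n_def a_def insert_commute)
  then show False
    using parent[of "vs ! i" "vs ! a"] parent[of "vs ! i" "vs ! b"] max ab ne inj
    by (metis inj_on_eq_iff)
qed

text \<open>Every cycle must lose an edge, and vertex-disjoint cycles lose different ones.\<close>

lemma far_if_disjoint_cycles:
  assumes "finite E" and cyc: "\<And>j. j < g \<Longrightarrow> is_cycle E (c j)"
    and disj: "\<And>i j. i < g \<Longrightarrow> j < g \<Longrightarrow> i \<noteq> j \<Longrightarrow> set (c i) \<inter> set (c j) = {}"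
    and "\<delta> * real (card E) < real g"
  shows "far_from_cycle_free \<delta> E"
  unfolding far_from_cycle_free_def
proof (intro allI impI)
  fix D assume D: "D \<subseteq> E" and free: "cycle_free (E - D)"
  \<comment> \<open>Nonemptiness matters for injectivity: the empty set would lie in several
    disjoint cycles at once.\<close>
  have "\<exists>d. d \<in> D \<and> d \<noteq> {} \<and> d \<subseteq> set (c j)" if j: "j < g" for j
  proof (rule ccontr)
    assume no: "\<nexists>d. d \<in> D \<and> d \<noteq> {} \<and> d \<subseteq> set (c j)"
    have ne: "c j \<noteq> []" using cyc[OF j] by (auto simp: is_cycle_def)
    then have "is_cycle (E - D) (c j)"
      using cyc[OF j] no unfolding is_cycle_def
      by (metis DiffI Suc_lessD empty_subsetI hd_in_set insert_not_empty insert_subset last_in_set nth_mem)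
    then show False using free by (auto simp: cycle_free_def)
  qed
  then obtain d where d: "\<And>j. j < g \<Longrightarrow> d j \<in> D \<and> d j \<noteq> {} \<and> d j \<subseteq> set (c j)" by metis
  have "inj_on d {..<g}"
    using d disj by (intro inj_onI) (metis Int_greatest lessThan_iff subset_empty)
  then have "card (d ` {..<g}) = g" by (simp add: card_image)
  moreover have "card (d ` {..<g}) \<le> card D"
    using d D assms(1) by (intro card_mono) (auto intro: finite_subset)
  ultimately show "\<delta> * real (card E) < real (card D)" using assms(4) by simp
qed

text \<open>The variable in row \<open>a\<close> and column \<open>b\<close> owns four vertices: the side (\<open>False\<close> where a path
  enters, \<open>True\<close> where it leaves) and the bit carried along the path distinguish them.\<close>

definition venc :: "nat \<Rightarrow> (nat \<times> nat) \<times> bool \<times> bool \<Rightarrow> nat" where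
  "venc k = (\<lambda>((a, b), s, c). 4 * (a * k + b) + 2 * of_bool s + of_bool c)"

text \<open>Each variable gets two edges, straight or crossed: a path flips its bit exactly at the
  variables in \<open>X\<close>.\<close>

definition alice_edges :: "nat \<Rightarrow> nat \<Rightarrow> (nat \<times> nat) set \<Rightarrow> edge set" where
  "alice_edges m k X =
    (\<lambda>(v, c). {venc k (v, False, c), venc k (v, True, c \<noteq> (v \<in> X))}) ` (({..<m} \<times> {..<k}) \<times> UNIV)"

text \<open>Consecutive columns of a gadget are joined with the bit preserved. One closing edge
  leads from bit \<open>w j\<close> at the end back to bit \<open>False\<close> at the
  start.\<close>

definition bob_edges :: "nat \<Rightarrow> nat \<Rightarrow> (nat \<times> nat \<Rightarrow> nat \<times> nat) \<Rightarrow> (nat \<Rightarrow> bool) \<Rightarrow> edge set" where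
  "bob_edges g k \<pi> w =
    (\<lambda>(j, b, c). {venc k (\<pi> (j, b), True, c), venc k (\<pi> (j, Suc b), False, c)}) ` ({..<g} \<times> {..<k - 1} \<times> UNIV) \<union>
    (\<lambda>j. {venc k (\<pi> (j, k - 1), True, w j), venc k (\<pi> (j, 0), False, False)}) ` {..<g}"

text \<open>The bit with which the path that starts the row with \<open>False\<close> enters column
  \<open>b\<close>.\<close>

fun prefix_parity :: "(nat \<times> nat \<Rightarrow> 'v) \<Rightarrow> 'v set \<Rightarrow> nat \<Rightarrow> nat \<Rightarrow> bool" where
  "prefix_parity \<pi> X j 0 = False"
| "prefix_parity \<pi> X j (Suc b) = (prefix_parity \<pi> X j b \<noteq> (\<pi> (j, b) \<in> X))"

lemma row_char_eq: "row_char k \<pi> j X = (if prefix_parity \<pi> X j k then - 1 else 1)"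
  unfolding row_char_def by (induction k) (auto simp: bsign_def)

lemma inj_on_venc: "inj_on (venc k) ((UNIV \<times> {..<k}) \<times> UNIV)"
proof (rule inj_onI)
  fix x y :: "(nat \<times> nat) \<times> bool \<times> bool"
  assume xy: "x \<in> (UNIV \<times> {..<k}) \<times> UNIV" "y \<in> (UNIV \<times> {..<k}) \<times> UNIV" and eq: "venc k x = venc k y"
  obtain a b s c where x: "x = ((a, b), s, c)" by (metis prod.exhaust)
  obtain a' b' s' c' where y: "y = ((a', b'), s', c')" by (metis prod.exhaust)
  have b: "b < k" "b' < k" using xy x y by auto
  define N N' where "N = a * k + b" and "N' = a' * k + b'"
  have "4 * N + 2 * of_bool s + of_bool c = 4 * N' + 2 * of_bool s' + (of_bool c' :: nat)"
    using eq by (simp add: x y venc_def N_def N'_def)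
  then have NN: "N = N' \<and> s = s' \<and> c = c'"
    by (cases s; cases s'; cases c; cases c') (simp_all, presburger+)
  moreover have "a = N div k" "b = N mod k" "a' = N' div k" "b' = N' mod k"
    using b by (auto simp: N_def N'_def)
  ultimately show "x = y" by (simp add: x y)
qed

lemma venc_eq_iff:
  assumes "snd v < k" "snd v' < k"
  shows "venc k (v, s, c) = venc k (v', s', c') \<longleftrightarrow> v = v' \<and> s = s' \<and> c = c'"
  using inj_on_eq_iff[OF inj_on_venc, of "(v, s, c)" k "(v', s', c')"] assms
  by (auto simp: mem_Times_iff)

lemma venc_less:
  assumes "v \<in> {..<m} \<times> {..<k}" "m * k \<le> n"
  shows "venc k (v, s, c) < 4 * n"
proof -
  obtain a b where v: "v = (a, b)" "a < m" "b < k" using assms(1) by auto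
  have "a * k + b < Suc a * k" using v by simp
  also have "\<dots> \<le> m * k" using v by (intro mult_le_mono1) simp
  finally have "a * k + b < n" using assms(2) by simp
  then show ?thesis by (simp add: venc_def v of_bool_def)
qed

lemma permutes_grid:
  assumes "\<pi> permutes ({..<m} \<times> {..<k})" "j < m" "b < k"
  shows "\<pi> (j, b) \<in> {..<m} \<times> {..<k}" "snd (\<pi> (j, b)) < k"
proof -
  show "\<pi> (j, b) \<in> {..<m} \<times> {..<k}" using assms by (simp only: permutes_in_image) simp
  then show "snd (\<pi> (j, b)) < k" by auto
qed

lemma alice_edges_subset:
  assumes "m * k \<le> n"
  shows "alice_edges m k X \<subseteq> all_edges (4 * n)"
proof
  fix e assume "e \<in> alice_edges m k X"
  then obtain v c where v: "v \<in> {..<m} \<times> {..<k}"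
    and e: "e = {venc k (v, False, c), venc k (v, True, c \<noteq> (v \<in> X))}"
    by (auto simp: alice_edges_def)
  have "snd v < k" using v by auto
  then have "venc k (v, False, c) \<noteq> venc k (v, True, c \<noteq> (v \<in> X))" by (simp add: venc_eq_iff)
  then show "e \<in> all_edges (4 * n)"
    unfolding e all_edges_def using venc_less[OF v assms] by blast
qed

section \<open>The graph formed by both halves of the stream\<close>

context
  fixes m k g :: nat and \<pi> :: "nat \<times> nat \<Rightarrow> nat \<times> nat"
  assumes \<pi>: "\<pi> permutes ({..<m} \<times> {..<k})" and gm: "g \<le> m" and k2: "2 \<le> k"
begin

lemma bob_edge_cases:
  assumes "e \<in> bob_edges g k \<pi> w"
  obtains j b c where "j < g" "Suc b < k" "e = {venc k (\<pi> (j, b), True, c), venc k (\<pi> (j, Suc b), False, c)}"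
  | j where "j < g" "e = {venc k (\<pi> (j, k - 1), True, w j), venc k (\<pi> (j, 0), False, False)}"
  using assms unfolding bob_edges_def
proof (elim UnE imageE)
  fix z assume z: "e = (\<lambda>(j, b, c). {venc k (\<pi> (j, b), True, c), venc k (\<pi> (j, Suc b), False, c)}) z"
    "z \<in> {..<g} \<times> {..<k - 1} \<times> UNIV"
  obtain j b c where "z = (j, b, c)" by (cases z)
  then show ?thesis using that(1)[of j b c] z by (simp add: less_diff_conv)
next
  fix j assume "e = {venc k (\<pi> (j, k - 1), True, w j), venc k (\<pi> (j, 0), False, False)}" "j \<in> {..<g}"
  then show ?thesis using that(2)[of j] by simp
qed

text \<open>This common form excludes loops and separates these edges from those of
  \<open>alice_edges\<close>, which stay within one variable. For the closing edge,
  \<open>2 \<le> k\<close> makes the two columns different.\<close>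

lemma bob_edge_ends:
  assumes "e \<in> bob_edges g k \<pi> w"
  obtains u v c d where "u \<in> {..<m} \<times> {..<k}" "v \<in> {..<m} \<times> {..<k}" "u \<noteq> v"
    "e = {venc k (u, True, c), venc k (v, False, d)}"
  using assms
proof (cases rule: bob_edge_cases)
  case (1 j b c)
  then have "\<pi> (j, b) \<noteq> \<pi> (j, Suc b)" using inj_eq[OF permutes_inj[OF \<pi>]] by simp
  then show ?thesis using that permutes_grid(1)[OF \<pi>, of j] 1 gm by (metis Suc_lessD order_less_le_trans)
next
  case (2 j)
  then have "\<pi> (j, k - 1) \<noteq> \<pi> (j, 0)" using inj_eq[OF permutes_inj[OF \<pi>]] k2 by simp
  moreover have "\<pi> (j, k - 1) \<in> {..<m} \<times> {..<k}" "\<pi> (j, 0) \<in> {..<m} \<times> {..<k}"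
    using 2 gm k2 by (auto intro!: permutes_grid(1)[OF \<pi>])
  ultimately show ?thesis using that[of "\<pi> (j, k - 1)" "\<pi> (j, 0)" "w j" False] 2(2) by simp
qed

lemma bob_edges_subset:
  assumes "m * k \<le> n"
  shows "bob_edges g k \<pi> w \<subseteq> all_edges (4 * n)"
proof
  fix e assume "e \<in> bob_edges g k \<pi> w"
  then obtain u v c d where uv: "u \<in> {..<m} \<times> {..<k}" "v \<in> {..<m} \<times> {..<k}" "u \<noteq> v"
    and e: "e = {venc k (u, True, c), venc k (v, False, d)}"
    by (rule bob_edge_ends)
  have "venc k (u, True, c) \<noteq> venc k (v, False, d)" using uv by (subst venc_eq_iff) auto
  then show "e \<in> all_edges (4 * n)"
    unfolding e all_edges_def using venc_less[OF uv(1) assms] venc_less[OF uv(2) assms] by blast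
qed

lemma alice_bob_disjoint: "alice_edges m k X \<inter> bob_edges g k \<pi> w = {}"
proof -
  have False if A: "e \<in> alice_edges m k X" and B: "e \<in> bob_edges g k \<pi> w" for e
  proof -
    obtain u v c d where uv: "u \<in> {..<m} \<times> {..<k}" "v \<in> {..<m} \<times> {..<k}" "u \<noteq> v"
      and e: "e = {venc k (u, True, c), venc k (v, False, d)}"
      using B by (rule bob_edge_ends)
    obtain z c' where z: "z \<in> {..<m} \<times> {..<k}"
      and e': "e = {venc k (z, False, c'), venc k (z, True, c' \<noteq> (z \<in> X))}"
      using A by (auto simp: alice_edges_def)
    have "snd u < k" "snd v < k" "snd z < k" using uv z by auto
    then show False using e e' uv(3) by (auto simp: doubleton_eq_iff venc_eq_iff)
  qed
  then show ?thesis by blast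
qed

lemma finite_instance: "finite (alice_edges m k X \<union> bob_edges g k \<pi> w)"
  by (simp add: alice_edges_def bob_edges_def)

lemma card_instance_le: "card (alice_edges m k X \<union> bob_edges g k \<pi> w) \<le> 2 * (m * k) + g * (2 * k - 1)"
proof -
  have "card (alice_edges m k X) \<le> card ((({..<m} \<times> {..<k}) \<times> (UNIV :: bool set)))"
    unfolding alice_edges_def by (rule card_image_le) simp
  also have "\<dots> = 2 * (m * k)" by (simp add: card_cartesian_product)
  finally have 1: "card (alice_edges m k X) \<le> 2 * (m * k)" .
  have "card (bob_edges g k \<pi> w) \<le> card ({..<g} \<times> {..<k - 1} \<times> (UNIV :: bool set)) + card {..<g}"
    unfolding bob_edges_def
    by (rule order_trans[OF card_Un_le]) (intro add_mono card_image_le; simp)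
  also have "\<dots> = g * (2 * k - 1)"
  proof -
    obtain k' where "k = Suc k'" using k2 by (cases k) auto
    then show ?thesis by (simp add: card_cartesian_product algebra_simps)
  qed
  finally have "card (bob_edges g k \<pi> w) \<le> g * (2 * k - 1)" .
  with 1 show ?thesis using card_Un_le[of "alice_edges m k X" "bob_edges g k \<pi> w"] by simp
qed

text \<open>With the wrong bit, the closing edge of a gadget links the end of one strand to the
  start of the other, so the two strands form a single path.\<close>

lemma instance_cycle_free:
  assumes w: "\<And>j. j < g \<Longrightarrow> w j \<noteq> prefix_parity \<pi> X j k"
  shows "cycle_free (alice_edges m k X \<union> bob_edges g k \<pi> w)"
proof -
  define q where "q = prefix_parity \<pi> X"
  define row where "row v = fst (inv \<pi> v)" for v
  define col where "col v = snd (inv \<pi> v)" for v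
  have rc [simp]: "row (\<pi> (j, b)) = j" "col (\<pi> (j, b)) = b" for j b
    unfolding row_def col_def using permutes_inverses(2)[OF \<pi>] by auto
  have rc_inv: "\<pi> (row v, col v) = v" for v
    unfolding row_def col_def using permutes_inverses(1)[OF \<pi>] by simp
  \<comment> \<open>Parents lie one step back along the path; the closing edge makes the end of the
    row the parent of its start.\<close>
  define par where "par = (\<lambda>(v, s, c). if s then (v, False, c \<noteq> (v \<in> X))
      else if col v = 0 then (\<pi> (row v, k - 1), True, w (row v)) else (\<pi> (row v, col v - 1), True, c))"
  \<comment> \<open>The height is the position along the row. The strand starting with
    \<open>False\<close> comes second and is lifted by \<open>2 * k\<close>, just above the top
    height \<open>2 * k - 1\<close> of the other strand.\<close>
  define h where "h = (\<lambda>(v, s, c). (if c = q (row v) (col v + of_bool s) then 2 * k else 0) + 2 * col v + of_bool s)"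
  define W where "W = (({..<m} \<times> {..<k}) \<times> (UNIV :: (bool \<times> bool) set))"
  have W: "(\<pi> (j, b), x) \<in> W" if "j < g" "b < k" for j b x
    unfolding W_def using permutes_grid(1)[OF \<pi>, of j b] that gm by auto
  show ?thesis
  proof (rule cycle_free_if_parent[of "venc k" W _ par h])
    show "inj_on (venc k) W" by (rule inj_on_subset[OF inj_on_venc]) (auto simp: W_def)
    fix e assume "e \<in> alice_edges m k X \<union> bob_edges g k \<pi> w"
    then consider "e \<in> alice_edges m k X" | "e \<in> bob_edges g k \<pi> w" by blast
    then show "\<exists>v\<in>W. par v \<in> W \<and> e = {venc k v, venc k (par v)} \<and> h (par v) < h v"
    proof cases
      case 1
      then obtain v c where v: "v \<in> {..<m} \<times> {..<k}"
        and e: "e = {venc k (v, False, c), venc k (v, True, c \<noteq> (v \<in> X))}"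
        by (auto simp: alice_edges_def)
      have par: "par (v, True, c \<noteq> (v \<in> X)) = (v, False, c)" by (auto simp: par_def)
      have "q (row v) (Suc (col v)) = (q (row v) (col v) \<noteq> (v \<in> X))"
        by (simp add: q_def rc_inv)
      then have "h (v, False, c) < h (v, True, c \<noteq> (v \<in> X))" by (auto simp: h_def)
      then show ?thesis
        using v e par by (intro bexI[of _ "(v, True, c \<noteq> (v \<in> X))"]) (auto simp: W_def)
    next
      case 2
      then show ?thesis
      proof (cases rule: bob_edge_cases)
        case (1 j b c)
        have "par (\<pi> (j, Suc b), False, c) = (\<pi> (j, b), True, c)" by (simp add: par_def)
        moreover have "h (\<pi> (j, b), True, c) < h (\<pi> (j, Suc b), False, c)" by (simp add: h_def)
        ultimately show ?thesis
          using 1 W[of j "Suc b"] W[of j b] by (intro bexI[of _ "(\<pi> (j, Suc b), False, c)"]) auto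
      next
        case (2 j)
        have "par (\<pi> (j, 0), False, False) = (\<pi> (j, k - 1), True, w j)" by (simp add: par_def)
        moreover have "h (\<pi> (j, k - 1), True, w j) < h (\<pi> (j, 0), False, False)"
          using w[OF 2(1)] k2 by (simp add: h_def q_def)
        ultimately show ?thesis
          using 2 k2 W[of j "k - 1"] W[of j 0] by (intro bexI[of _ "(\<pi> (j, 0), False, False)"]) auto
      qed
    qed
  qed
qed

text \<open>With the right bit, the strand starting with \<open>False\<close> closes to a cycle of
  length \<open>2 * k\<close>. The \<open>g\<close> cycles are vertex-disjoint, and there are fewer
  than \<open>4 * k * g = 8 * t * g\<close> edges.\<close>

lemma instance_far:
  assumes w: "\<And>j. j < g \<Longrightarrow> w j = prefix_parity \<pi> X j k"
    and k: "k = 2 * t" and g: "2 * k * (m - g) < g"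
  shows "far_from_cycle_free (1 / (8 * real t)) (alice_edges m k X \<union> bob_edges g k \<pi> w)"
proof -
  define E where "E = alice_edges m k X \<union> bob_edges g k \<pi> w"
  define q where "q = prefix_parity \<pi> X"
  \<comment> \<open>Position \<open>2 * b\<close> is the entering side of column \<open>b\<close>
    with bit \<open>q j b\<close>, position \<open>2 * b + 1\<close> its leaving side with bit
    \<open>q j (Suc b)\<close>.\<close>
  define x where "x j i = venc k (\<pi> (j, i div 2), odd i, q j (Suc i div 2))" for j i
  define c where "c j = map (x j) [0..<2 * k]" for j
  have x_eq: "x j i = x j' i' \<longleftrightarrow> j = j' \<and> i = i'" if "j < g" "j' < g" "i < 2 * k" "i' < 2 * k" for i j i' j'
  proof -
    have "snd (\<pi> (j, i div 2)) < k" "snd (\<pi> (j', i' div 2)) < k"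
      using that gm by (auto intro!: permutes_grid(2)[OF \<pi>])
    then have "x j i = x j' i' \<Longrightarrow> j = j' \<and> i div 2 = i' div 2 \<and> odd i = odd i'"
      unfolding x_def using inj_eq[OF permutes_inj[OF \<pi>]] by (simp add: venc_eq_iff)
    then show ?thesis by (metis odd_two_times_div_two_succ even_two_times_div_two)
  qed
  have alice: "{x j (2 * b), x j (Suc (2 * b))} \<in> E" if "j < g" "b < k" for j b
  proof -
    have "{venc k (\<pi> (j, b), False, q j b), venc k (\<pi> (j, b), True, q j b \<noteq> (\<pi> (j, b) \<in> X))} \<in> alice_edges m k X"
      unfolding alice_edges_def
      by (rule image_eqI[of _ _ "(\<pi> (j, b), q j b)"]) (use permutes_grid(1)[OF \<pi>, of j b] that gm in auto)
    then show ?thesis by (simp add: E_def x_def q_def)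
  qed
  have bob: "{x j (Suc (2 * b)), x j (Suc (Suc (2 * b)))} \<in> E" if "j < g" "Suc b < k" for j b
  proof -
    have "{venc k (\<pi> (j, b), True, q j (Suc b)), venc k (\<pi> (j, Suc b), False, q j (Suc b))} \<in> bob_edges g k \<pi> w"
      unfolding bob_edges_def
      by (rule UnI1, rule image_eqI[of _ _ "(j, b, q j (Suc b))"]) (use that in auto)
    then show ?thesis by (simp add: E_def x_def)
  qed
  have "is_cycle E (c j)" if j: "j < g" for j
    unfolding is_cycle_def
  proof (intro conjI allI impI)
    show "3 \<le> length (c j)" using k2 by (simp add: c_def)
    show "distinct (c j)" using x_eq j by (simp add: c_def distinct_map inj_on_def)
    show "{c j ! i, c j ! Suc i} \<in> E" if "Suc i < length (c j)" for i
    proof -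
      have i: "Suc i < 2 * k" using that by (simp add: c_def)
      then have "{x j i, x j (Suc i)} \<in> E"
      proof (cases "even i")
        case True
        then obtain b where "i = 2 * b" by (elim evenE)
        then show ?thesis using alice[OF j, of b] i by simp
      next
        case False
        then obtain b where "i = Suc (2 * b)" by (metis oddE Suc_eq_plus1)
        then show ?thesis using bob[OF j, of b] i by simp
      qed
      then show ?thesis using i by (simp add: c_def)
    qed
    have "last (c j) = x j (2 * k - 1)" "hd (c j) = x j 0"
      using k2 by (auto simp: c_def last_conv_nth hd_conv_nth)
    moreover have "x j (2 * k - 1) = venc k (\<pi> (j, k - 1), True, w j)"
    proof -
      have "(2 * k - 1) div 2 = k - 1" "odd (2 * k - 1)" "Suc (2 * k - 1) div 2 = k" using k2 by auto
      then show ?thesis using w[OF j] by (simp add: x_def q_def)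
    qed
    moreover have "x j 0 = venc k (\<pi> (j, 0), False, False)" by (simp add: x_def q_def)
    ultimately show "{last (c j), hd (c j)} \<in> E" using j by (auto simp: E_def bob_edges_def)
  qed
  moreover have "set (c i) \<inter> set (c j) = {}" if "i < g" "j < g" "i \<noteq> j" for i j
    using x_eq that by (auto simp: c_def)
  moreover have "1 / (8 * real t) * real (card E) < real g"
  proof -
    \<comment> \<open>A gadget has at most \<open>4 * k - 1\<close> edges. The one edge saved per
      gadget leaves room for the fewer than \<open>g\<close> edges in the \<open>m - g\<close>
      remaining rows.\<close>
    have "card E < 4 * k * g"
    proof -
      have "m = g + (m - g)" using gm by simp
      then have "2 * (m * k) = 2 * k * g + 2 * k * (m - g)"
        by (metis add_mult_distrib2 mult.assoc mult.commute)
      moreover have "g * (2 * k - 1) + g = 2 * k * g"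
        using k2 by (simp add: right_diff_distrib')
      ultimately show ?thesis using card_instance_le[of X w] g unfolding E_def by simp
    qed
    then have "real (card E) < real (4 * k * g)" by (simp only: of_nat_less_iff)
    then show ?thesis using k k2 by (simp add: field_simps)
  qed
  ultimately show ?thesis
    using far_if_disjoint_cycles[of E g c] finite_instance unfolding E_def by blast
qed

end

section \<open>The space bound\<close>

definition stream_of :: "edge set \<Rightarrow> edge list" where
  "stream_of E = (SOME es. set es = E \<and> distinct es)"

lemma stream_of:
  assumes "finite E"
  shows "set (stream_of E) = E" "distinct (stream_of E)"
  using someI_ex[OF finite_distinct_list[OF assms]] by (auto simp: stream_of_def)

definition resume :: "machine \<Rightarrow> bool list \<Rightarrow> edge list \<Rightarrow> bool list pmf" where
  "resume M \<sigma> es = foldl (\<lambda>\<sigma> e. bind_pmf \<sigma> (update M e)) (return_pmf \<sigma>) es"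

lemma memory_after_append:
  "memory_after M (xs @ ys) = bind_pmf (memory_after M xs) (\<lambda>\<sigma>. resume M \<sigma> ys)"
proof (induction ys rule: rev_induct)
  case Nil
  then show ?case by (simp add: resume_def bind_return_pmf')
next
  case (snoc y ys)
  have "memory_after M (xs @ ys @ [y]) = bind_pmf (memory_after M (xs @ ys)) (update M y)"
    by (simp add: memory_after_def)
  then show ?case unfolding snoc by (simp add: resume_def bind_assoc_pmf)
qed

definition reject :: "machine \<Rightarrow> edge list \<Rightarrow> real" where
  "reject M es = pmf (bind_pmf (memory_after M es) (verdict M)) False"

lemma reject_bounds: "0 \<le> reject M es" "reject M es \<le> 1"
  by (simp_all add: reject_def pmf_le_1)

lemma answer_False: "pmf (answer A es) False = (\<integral>M. reject M es \<partial>measure_pmf A)"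
  by (simp add: answer_def reject_def pmf_bind)

text \<open>Given the memory \<open>\<sigma>\<close> at the cut, the halves contribute separate
  factors. This is the product form \<open>f * G\<close> that \<open>hybrid_step\<close>
  requires.\<close>

lemma reject_append:
  assumes "finite S" "set_pmf (memory_after M xs) \<subseteq> S"
  shows "reject M (xs @ ys) =
    (\<Sum>\<sigma>\<in>S. pmf (memory_after M xs) \<sigma> * pmf (bind_pmf (resume M \<sigma> ys) (verdict M)) False)"
proof -
  have "reject M (xs @ ys) =
      (\<integral>\<sigma>. pmf (bind_pmf (resume M \<sigma> ys) (verdict M)) False \<partial>measure_pmf (memory_after M xs))"
    by (simp add: reject_def memory_after_append bind_assoc_pmf pmf_bind)
  also have "\<dots> = (\<Sum>\<sigma>\<in>S. pmf (bind_pmf (resume M \<sigma> ys) (verdict M)) False * pmf (memory_after M xs) \<sigma>)"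
    using assms by (intro integral_measure_pmf_real) auto
  finally show ?thesis by (simp add: mult.commute)
qed

lemma card_bitstrings_le: "card {\<sigma> :: bool list. length \<sigma> \<le> s} \<le> 2 ^ Suc s"
proof -
  have "card {\<sigma> :: bool list. length \<sigma> \<le> s} = (\<Sum>i\<le>s. 2 ^ i)"
    using card_lists_length_le[of "UNIV :: bool set" s] by simp
  also have "\<dots> \<le> 2 ^ Suc s" by (induction s) auto
  finally show ?thesis .
qed

lemma finite_bitstrings: "finite {\<sigma> :: bool list. length \<sigma> \<le> s}"
  using finite_lists_length_le[of "UNIV :: bool set" s] by simp

lemma bool_pmf_sum: "pmf q True + pmf q False = 1"
  by (simp add: pmf_False_conv_True)

section \<open>The hybrid argument on random instances\<close>

context
  fixes t k L g m n :: nat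
  assumes t: "t \<ge> 1" and k: "k = 2 * t" and L: "L > 0" and g: "g = 3 * k * L" and m: "m = g + L"
    and mn: "m * k \<le> n"
begin

text \<open>The first half depends on \<open>X\<close> alone; the second sees \<open>X\<close> only
  through the gadget bits.\<close>

definition instance_stream :: "(nat \<times> nat) set \<Rightarrow> (nat \<times> nat \<Rightarrow> nat \<times> nat) \<Rightarrow> nat \<Rightarrow> edge list" where
  "instance_stream X \<pi> i = stream_of (alice_edges m k X) @ stream_of (bob_edges g k \<pi> (hybrid g k i \<pi> X))"

lemma alice_stream: "graph_stream (4 * n) (stream_of (alice_edges m k X))"
proof -
  have "finite (alice_edges m k X)" by (simp add: alice_edges_def)
  then show ?thesis using alice_edges_subset[OF mn] by (simp add: graph_stream_def stream_of)
qed

lemma instance_stream_facts: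
  assumes "\<pi> permutes ({..<m} \<times> {..<k})"
  shows "graph_stream (4 * n) (instance_stream X \<pi> i)"
    and "cycle_free (set (instance_stream X \<pi> 0))"
    and "far_from_cycle_free (1 / (8 * real t)) (set (instance_stream X \<pi> g))"
proof -
  have gm: "g \<le> m" and k2: "2 \<le> k" using m t k by auto
  note inst = assms gm k2
  have fin: "finite (alice_edges m k X)" "finite (bob_edges g k \<pi> w)" for w
    using finite_instance[OF inst] by (auto simp: finite_Un)
  have set: "set (instance_stream X \<pi> i) = alice_edges m k X \<union> bob_edges g k \<pi> (hybrid g k i \<pi> X)" for i
    by (simp add: instance_stream_def stream_of fin)
  show "graph_stream (4 * n) (instance_stream X \<pi> i)"
    unfolding graph_stream_def set
    using alice_edges_subset[OF mn] bob_edges_subset[OF inst mn] alice_bob_disjoint[OF inst]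
    by (simp add: instance_stream_def stream_of fin)
  show "cycle_free (set (instance_stream X \<pi> 0))"
    unfolding set by (rule instance_cycle_free[OF inst]) (simp add: hybrid_def row_char_eq)
  show "far_from_cycle_free (1 / (8 * real t)) (set (instance_stream X \<pi> g))"
    unfolding set
  proof (rule instance_far[OF inst _ k])
    show "hybrid g k g \<pi> X j = prefix_parity \<pi> X j k" if "j < g" for j
      using that by (simp add: hybrid_def row_char_eq)
    \<comment> \<open>Here \<open>m - g = L\<close> and \<open>g = 3 * k * L\<close>, so the factor
      3 provides the strict inequality.\<close>
    show "2 * k * (m - g) < g" using L k t by (simp add: g m)
  qed
qed

text \<open>Without memory the answer has the same distribution on all streams, so it cannot be
  right with probability above 1/2 on both kinds of graphs.\<close>

lemma space_positive:
  assumes "p > 1 / 2" "distinguishes_cycle_free (4 * n) (1 / (8 * real t)) p A" "uses_at_most_bits (4 * n) A s"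
  shows "s \<ge> 1"
proof (rule ccontr)
  assume "\<not> s \<ge> 1"
  then have s: "s = 0" by simp
  have *: "answer A es = bind_pmf A (\<lambda>M. verdict M [])" if es: "graph_stream (4 * n) es" for es
    unfolding answer_def
  proof (rule bind_pmf_cong[OF refl])
    fix M assume "M \<in> set_pmf A"
    then have "set_pmf (memory_after M es) \<subseteq> {[]}"
      using assms(3) es by (auto simp: uses_at_most_bits_def s)
    then have "memory_after M es = return_pmf []" by (simp add: set_pmf_subset_singleton)
    then show "bind_pmf (memory_after M es) (verdict M) = verdict M []" by (simp add: bind_return_pmf)
  qed
  note facts = instance_stream_facts[OF permutes_id, of "{}"]
  have "pmf (answer A (instance_stream {} id 0)) True \<ge> p" "pmf (answer A (instance_stream {} id g)) False \<ge> p"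
    using assms(2) facts by (auto simp: distinguishes_cycle_free_def)
  then show False
    using assms(1) bool_pmf_sum[of "bind_pmf A (\<lambda>M. verdict M [])"] *[OF facts(1)] by simp
qed

text \<open>The difference telescopes over the \<open>g\<close> single flips, each bounded by
  \<open>hybrid_step\<close> with \<open>r = s\<close>.\<close>

lemma advantage_le:
  assumes s: "s \<ge> 1" and M: "\<And>es \<sigma>. graph_stream (4 * n) es \<Longrightarrow> \<sigma> \<in> set_pmf (memory_after M es) \<Longrightarrow> length \<sigma> \<le> s"
    and V: "V = {..<m} \<times> {..<k}"
  shows "(\<Sum>\<pi> | \<pi> permutes V. \<Sum>X\<in>Pow V. reject M (instance_stream X \<pi> g) - reject M (instance_stream X \<pi> 0))
    \<le> real g * (real (card {\<pi>. \<pi> permutes V}) * 2 ^ card V * (4 * (2 * real s * (real k)\<^sup>2 / real L) ^ t))"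
proof -
  define S where "S = {\<sigma> :: bool list. length \<sigma> \<le> s}"
  define f where "f \<sigma> X = pmf (memory_after M (stream_of (alice_edges m k X))) \<sigma>" for \<sigma> X
  define G where "G \<sigma> \<pi> w = pmf (bind_pmf (resume M \<sigma> (stream_of (bob_edges g k \<pi> w))) (verdict M)) False" for \<sigma> \<pi> w
  have finS: "finite S" unfolding S_def by (rule finite_bitstrings)
  \<comment> \<open>There are at most \<open>2 ^ Suc s\<close> memory states, and
    \<open>Suc s \<le> 2 * s\<close> because \<open>s \<ge> 1\<close>.\<close>
  have cardS: "card S \<le> 2 ^ (2 * s)"
    unfolding S_def by (rule order_trans[OF card_bitstrings_le]) (use s in \<open>intro power_increasing, auto\<close>)
  have supp: "set_pmf (memory_after M (stream_of (alice_edges m k X))) \<subseteq> S" for X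
    unfolding S_def using M[OF alice_stream] by blast
  have rej: "reject M (instance_stream X \<pi> i) = (\<Sum>\<sigma>\<in>S. f \<sigma> X * G \<sigma> \<pi> (hybrid g k i \<pi> X))" for X \<pi> i
    unfolding instance_stream_def f_def G_def by (rule reject_append[OF finS supp])
  have f1: "(\<Sum>\<sigma>\<in>S. f \<sigma> X) \<le> 1" for X
    unfolding f_def using sum_pmf_eq_1[OF finS supp] by simp
  have "(\<Sum>\<pi> | \<pi> permutes V. \<Sum>X\<in>Pow V. reject M (instance_stream X \<pi> g) - reject M (instance_stream X \<pi> 0)) =
      (\<Sum>\<pi> | \<pi> permutes V. \<Sum>X\<in>Pow V. \<Sum>i<g.
        reject M (instance_stream X \<pi> (Suc i)) - reject M (instance_stream X \<pi> i))"
  proof (intro sum.cong refl)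
    fix \<pi> X
    show "reject M (instance_stream X \<pi> g) - reject M (instance_stream X \<pi> 0) =
        (\<Sum>i<g. reject M (instance_stream X \<pi> (Suc i)) - reject M (instance_stream X \<pi> i))"
      by (rule sum_lessThan_telescope[of "\<lambda>i. reject M (instance_stream X \<pi> i)", symmetric])
  qed
  also have "\<dots> = (\<Sum>i<g. \<Sum>\<pi> | \<pi> permutes V. \<Sum>X\<in>Pow V.
        reject M (instance_stream X \<pi> (Suc i)) - reject M (instance_stream X \<pi> i))"
    by (subst sum.swap[of _ "{..<g}"], subst sum.swap[of _ "{..<g}"]) (rule refl)
  also have "\<dots> \<le> (\<Sum>i<g. real (card {\<pi>. \<pi> permutes V}) * 2 ^ card V * (4 * (2 * real s * (real k)\<^sup>2 / real L) ^ t))"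
  proof (rule sum_mono)
    fix i assume "i \<in> {..<g}"
    then have i: "i < g" by simp
    show "(\<Sum>\<pi> | \<pi> permutes V. \<Sum>X\<in>Pow V. reject M (instance_stream X \<pi> (Suc i)) - reject M (instance_stream X \<pi> i))
        \<le> real (card {\<pi>. \<pi> permutes V}) * 2 ^ card V * (4 * (2 * real s * (real k)\<^sup>2 / real L) ^ t)"
      unfolding rej sum_subtractf[symmetric] right_diff_distrib[symmetric]
    proof (rule hybrid_step[OF i L _ _ k _ finS cardS])
      show "V = {..<g + L} \<times> {..<k}" using V m by simp
      show "s > 0" "t > 0" using s t by auto
    qed (use f1 in \<open>auto simp: f_def G_def pmf_le_1\<close>)
  qed
  finally show ?thesis by simp
qed

text \<open>Correctness gives a gap of \<open>2 * p - 1\<close> on every instance. Summing over all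
  instances and exchanging the finite sums with the expectation over machines reduces the claim to
  \<open>advantage_le\<close> for each machine in the support.\<close>

lemma space_tradeoff:
  assumes "s \<ge> 1" and dist: "distinguishes_cycle_free (4 * n) (1 / (8 * real t)) p A"
    and bits: "uses_at_most_bits (4 * n) A s"
  shows "2 * p - 1 \<le> real g * (4 * (2 * real s * (real k)\<^sup>2 / real L) ^ t)"
proof -
  define V where "V = {..<m} \<times> {..<k}"
  define P where "P = {\<pi>. \<pi> permutes V}"
  define K where "K = real (card P) * 2 ^ card V"
  define C where "C = real g * (4 * (2 * real s * (real k)\<^sup>2 / real L) ^ t)"
  define \<Phi> where "\<Phi> M = (\<Sum>\<pi>\<in>P. \<Sum>X\<in>Pow V. reject M (instance_stream X \<pi> g) - reject M (instance_stream X \<pi> 0))" for M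
  have finV: "finite V" by (simp add: V_def)
  have finP: "finite P" unfolding P_def using finV by (rule finite_permutations)
  have "id \<in> P" by (simp add: P_def permutes_id)
  then have "card P > 0" using finP by (auto simp: card_gt_0_iff)
  then have K0: "K > 0" by (simp add: K_def)
  have int: "integrable (measure_pmf A) (\<lambda>M. reject M es)" for es
    using reject_bounds by (intro measure_pmf.integrable_const_bound[where B = 1]) auto
  have gap: "2 * p - 1 \<le> pmf (answer A (instance_stream X \<pi> g)) False - pmf (answer A (instance_stream X \<pi> 0)) False"
    if "\<pi> \<in> P" for X \<pi>
  proof -
    have \<pi>: "\<pi> permutes ({..<m} \<times> {..<k})" using that by (simp add: P_def V_def)
    have "pmf (answer A (instance_stream X \<pi> g)) False \<ge> p" "pmf (answer A (instance_stream X \<pi> 0)) True \<ge> p"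
      using dist instance_stream_facts[OF \<pi>] by (auto simp: distinguishes_cycle_free_def)
    then show ?thesis using bool_pmf_sum[of "answer A (instance_stream X \<pi> 0)"] by simp
  qed
  have "K * (2 * p - 1) = (\<Sum>\<pi>\<in>P. \<Sum>X\<in>Pow V. 2 * p - 1)"
    using finV by (simp add: K_def card_Pow)
  also have "\<dots> \<le> (\<Sum>\<pi>\<in>P. \<Sum>X\<in>Pow V.
      pmf (answer A (instance_stream X \<pi> g)) False - pmf (answer A (instance_stream X \<pi> 0)) False)"
    using gap by (intro sum_mono) auto
  also have "\<dots> = (\<integral>M. \<Phi> M \<partial>measure_pmf A)"
    unfolding \<Phi>_def answer_False using int by simp
  also have "\<dots> \<le> K * C"
  proof (rule measure_pmf.integral_le_const)
    show "integrable (measure_pmf A) \<Phi>" unfolding \<Phi>_def using int by simp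
    have "\<Phi> M \<le> K * C" if "M \<in> set_pmf A" for M
    proof -
      have "\<Phi> M \<le> real g * (real (card {\<pi>. \<pi> permutes V}) * 2 ^ card V * (4 * (2 * real s * (real k)\<^sup>2 / real L) ^ t))"
        unfolding \<Phi>_def P_def
        using bits that assms(1) by (intro advantage_le) (auto simp: uses_at_most_bits_def V_def)
      also have "\<dots> = K * C" by (simp add: K_def C_def P_def)
      finally show ?thesis .
    qed
    then show "AE M in measure_pmf A. \<Phi> M \<le> K * C" by (simp add: AE_measure_pmf_iff)
  qed
  finally show ?thesis using K0 by (simp add: C_def)
qed

end

section \<open>Choice of parameters and the asymptotic bound\<close>

theorem theorem5p6:
  fixes t :: nat and p :: real
    and A :: "nat \<Rightarrow> streaming_algorithm" and s :: "nat \<Rightarrow> nat"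
  assumes "t \<ge> 1"
    and "p > 1 / 2"
    and "\<And>n. distinguishes_cycle_free (4 * n) (1 / (8 * real t)) p (A n)"
    and "\<And>n. uses_at_most_bits (4 * n) (A n) (s n)"
  shows "(\<lambda>n. real (s n)) \<in> \<Omega>(\<lambda>n. real n powr (1 - 1 / real t))"
proof -
  define k where "k = 2 * t"
  \<comment> \<open>The grid has \<open>(g + L) * k = D * L\<close> variables, so
    \<open>L = n div D\<close> is the largest choice that fits.\<close>
  define D where "D = (3 * k + 1) * k"
  \<comment> \<open>\<open>c\<^sub>0\<close> results from solving \<open>space_tradeoff\<close> for
    \<open>s ^ t\<close>, which gives \<open>c\<^sub>0 * L ^ (t - 1) \<le> s ^ t\<close>. Then
    \<open>c\<^sub>1\<close> accounts for \<open>L \<ge> n / (2 * D)\<close>, and the minimum with 1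
    ensures \<open>c ^ t \<le> c\<^sub>1\<close>.\<close>
  define c\<^sub>0 where "c\<^sub>0 = (2 * p - 1) / (12 * real k * (2 * (real k)\<^sup>2) ^ t)"
  define c\<^sub>1 where "c\<^sub>1 = c\<^sub>0 / (2 * real D) ^ (t - 1)"
  define c where "c = min 1 c\<^sub>1"
  have k0: "k > 0" and D0: "D > 0" using assms(1) by (auto simp: k_def D_def)
  have c0: "c\<^sub>0 > 0" using assms(2) k0 by (simp add: c\<^sub>0_def)
  then have "c\<^sub>1 > 0" using D0 by (simp add: c\<^sub>1_def)
  then have c: "0 < c" "c \<le> 1" "c \<le> c\<^sub>1" by (auto simp: c_def)
  have bound: "c * real n powr (1 - 1 / real t) \<le> real (s n)" if n: "n \<ge> D" for n
  proof -
    define L where "L = n div D"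
    define g where "g = 3 * k * L"
    have L: "L > 0" unfolding L_def using n D0 by (simp add: div_greater_zero_iff)
    have "(g + L) * k = D * L" by (simp add: g_def D_def algebra_simps)
    also have "\<dots> \<le> n" by (simp add: L_def)
    finally have mn: "(g + L) * k \<le> n" .
    note params = assms(1) k_def L g_def refl[of "g + L"] mn
    have s: "s n \<ge> 1" by (rule space_positive[OF params assms(2,3,4)])
    have "n < D * Suc L" unfolding L_def using D0 by (rule dividend_less_times_div[THEN order_less_le_trans]) simp
    also have "\<dots> \<le> 2 * D * L" using L by simp
    finally have "real n \<le> real (2 * D * L)" by (simp only: of_nat_le_iff)
    then have nL: "real n / (2 * real D) \<le> real L" using D0 by (simp add: field_simps)
    have "2 * p - 1 \<le> real g * (4 * (2 * real (s n) * (real k)\<^sup>2 / real L) ^ t)"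
      by (rule space_tradeoff[OF params s assms(3,4)])
    also have "\<dots> = 12 * real k * (2 * (real k)\<^sup>2) ^ t * (real (s n) ^ t * (real L / real L ^ t))"
      by (simp add: g_def power_mult_distrib power_divide)
    also have "real L / real L ^ t = 1 / real L ^ (t - 1)"
      using L assms(1) by (cases t) auto
    finally have "c\<^sub>0 * real L ^ (t - 1) \<le> real (s n) ^ t"
      using k0 L unfolding c\<^sub>0_def by (simp add: field_simps)
    moreover have "(real n / (2 * real D)) ^ (t - 1) \<le> real L ^ (t - 1)"
      using nL by (intro power_mono) auto
    ultimately have st: "c\<^sub>1 * real n ^ (t - 1) \<le> real (s n) ^ t"
      using c0 mult_left_mono[of "(real n / (2 * real D)) ^ (t - 1)" "real L ^ (t - 1)" c\<^sub>0]
      by (simp add: c\<^sub>1_def power_divide)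
    have n0: "real n > 0" using n D0 by simp
    have "(real n powr (1 - 1 / real t)) ^ t = real n powr ((1 - 1 / real t) * real t)"
      using n0 by (simp add: powr_powr flip: powr_realpow)
    also have "(1 - 1 / real t) * real t = real (t - 1)"
      using assms(1) by (simp add: field_simps of_nat_diff)
    finally have pw: "(real n powr (1 - 1 / real t)) ^ t = real n ^ (t - 1)"
      using n0 by (simp add: powr_realpow)
    \<comment> \<open>The bound is proved for the \<open>t\<close>-th powers; the root is taken at
      the end.\<close>
    have "(c * real n powr (1 - 1 / real t)) ^ t = c ^ t * real n ^ (t - 1)"
      by (simp add: power_mult_distrib pw)
    also have "\<dots> \<le> c\<^sub>1 * real n ^ (t - 1)"
    proof (rule mult_right_mono)
      have "c ^ t \<le> c ^ 1" using c assms(1) by (intro power_decreasing) auto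
      then show "c ^ t \<le> c\<^sub>1" using c by simp
    qed simp
    also note st
    finally show ?thesis
      using assms(1) c by (subst (asm) power_mono_iff) auto
  qed
  show ?thesis
  proof (rule landau_omega.bigI[where c = c])
    show "\<forall>\<^sub>F n in at_top. c * norm (real n powr (1 - 1 / real t)) \<le> norm (real (s n))"
      using eventually_ge_at_top[of D] by eventually_elim (use bound in simp)
  qed (rule c)
qed

end
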